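(* Let $b$ be a prime, $s,m\in\mathbb{N}$, $p\in\mathbb{F}_b[x]$ with $\deg(p)=m$, $\boldsymbol{q}\in(G_m\setminus\{0\})^s$, and $N=b^m$. Let $\alpha>1/2$ be real and let $\boldsymbol{\gamma}=(\gamma_u)_u$, $\boldsymbol{\gamma}'=(\gamma'_u)_u$ be families of non-negative real weights such that $\gamma_v\ge\gamma_u$ whenever $v\subset u$. Then $$D^*_{\boldsymbol{\gamma}',b^m}(\boldsymbol{q})\le\sum_{\emptyset\ne u\subseteq\{1,\ldots,s\}}\gamma'_u\left[1-\left(1-\frac1N\right)^{|u|}+(b-1)\frac{(\rho_{\alpha,\boldsymbol{\gamma},b^m}(\boldsymbol{q}))^{1/(2\alpha)}}{\gamma_u^{1/(2\alpha)}}\bigl(k_b(m+1)\bigr)^{|u|}\right],$$ where $k_2=1$ and $k_b=1+1/\sin(\pi/b)$ for a prime $b>2$.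
   Context: $\mathbb{N}$ is the set of positive integers; $\mathbb{F}_b$ is the field with $b$ elements, identified with $\{0,\ldots,b-1\}$; $G_m=\{g\in\mathbb{F}_b[x]:\deg(g)<m\}$ (including $0$). Weights are families $\boldsymbol{\gamma}=(\gamma_u)$ of non-negative reals indexed by the finite non-empty subsets $u\subset\mathbb{N}$. Polynomial lattice point set: for a formal Laurent series put $\nu_m\bigl(\sum_{i=w}^\infty t_ix^{-i}\bigr)=\sum_{i=\max(w,1)}^m t_ib^{-i}\in[0,1)$. The point set $P(p,\boldsymbol{q})$ consists of the $b^m$ points (counted with multiplicity) $\bigl(\nu_m(nq_1/p),\ldots,\nu_m(nq_s/p)\bigr)$, $n\in G_m$, where $nq_j/p$ is expanded as a Laurent series in $x^{-1}$ over $\mathbb{F}_b$. Weighted star discrepancy: for a point set $P$ of $N$ points in $[0,1)^s$ and non-empty $u\subseteq\{1,\ldots,s\}$, let $P_u$ be the projection (with multiplicity) of $P$ onto the coordinates in $u$. For $\boldsymbol{y}_u\in[0,1)^{|u|}$ let $$\Delta_{P_u}(\boldsymbol{y}_u)=\frac1N\sum_{\boldsymbol{x}_u\in P_u}1_{[\boldsymbol{0},\boldsymbol{y}_u)}(\boldsymbol{x}_u)-\prod_{j\in u}y_j,\qquad [\boldsymbol{0},\boldsymbol{y}_u)=\prod_{j\in u}[0,y_j),$$ and $$D^*_{\boldsymbol{\gamma},N}(P)=\max_{\emptyset\ne u\subseteq\{1,\ldots,s\}}\gamma_u\sup_{\boldsymbol{y}_u\in[0,1)^{|u|}}|\Delta_{P_u}(\boldsymbol{y}_u)|.$$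 Write $D^*_{\boldsymbol{\gamma},b^m}(\boldsymbol{q})=D^*_{\boldsymbol{\gamma},b^m}(P(p,\boldsymbol{q}))$. For an integer $k\ge0$ with $b$-adic expansion $k=\kappa_0+\kappa_1b+\cdots$ let $\mathrm{tr}_m(k)=\kappa_0+\kappa_1x+\cdots+\kappa_{m-1}x^{m-1}\in G_m$. For $k=\kappa_0+\cdots+\kappa_{a-1}b^{a-1}\in\mathbb{N}$ with $\kappa_{a-1}\ne0$ let $\mu(k)=a$; for $\boldsymbol{k}_u\in\mathbb{N}^{|u|}$ let $\mu(\boldsymbol{k}_u)=\sum_{j\in u}\mu(k_j)$ and $r_\alpha(\boldsymbol{\gamma},\boldsymbol{k}_u)=\gamma_ub^{-2\alpha\mu(\boldsymbol{k}_u)}$. For non-empty $u\subseteq\{1,\ldots,s\}$ let $$P_u^\perp(p,\boldsymbol{q})=\Bigl\{\boldsymbol{k}_u\in\mathbb{N}^{|u|}:\sum_{j\in u}\mathrm{tr}_m(k_j)\,q_j\equiv0 \pmod p\Bigr\},$$ and $$\rho_{\alpha,\boldsymbol{\gamma},b^m}(\boldsymbol{q})=\max_{\emptyset\ne u\subseteq\{1,\ldots,s\}}\ \max_{\boldsymbol{k}_u\in P_u^\perp(p,\boldsymbol{q})}r_\alpha(\boldsymbol{\gamma},\boldsymbol{k}_u).$$ Convention: $0/0=0$ for the ratio $\gamma'_u/\gamma_u^{1/(2\alpha)}$; if $\gamma_u=0<\gamma'_u$ for some non-empty $u\subseteq\{1,\ldots,s\}$, the right-hand side is read as $+\infty$.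 *)

theory Defs
  imports
    "HOL-Analysis.Analysis"
    "HOL-Computational_Algebra.Formal_Laurent_Series"
    "HOL-Library.Log_Nat"
    "HOL-Number_Theory.Cong"
    "Berlekamp_Zassenhaus.Finite_Field"
begin

text \<open>
  The field with \<open>b\<close> elements is the type \<open>'b mod_ring\<close> with \<open>'b :: prime_card\<close> and
  \<open>b = CARD('b)\<close>, a prime; \<open>of_nat\<close> and \<open>to_int_mod_ring\<close> realise its identification with
  \<open>{0..b-1}\<close>. Coordinates are numbered \<open>1..s\<close>; a vector indexed by \<open>u\<close> is a function in
  an extensional product over \<open>u\<close>.
\<close>

definition nonempty_subsets :: "nat \<Rightarrow> nat set set" where
  "nonempty_subsets s = Pow {1..s} - {{}}"

definition polys_below :: "nat \<Rightarrow> 'b::prime_card mod_ring poly set" where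
  "polys_below m = {g. g = 0 \<or> Polynomial.degree g < m}"


subsection \<open>Polynomial lattice point sets\<close>

text \<open>
  The indeterminate of \<open>fls\<close> plays the role of $x^{-1}$, so a polynomial in $x$ is evaluated at
  \<open>fls_X_inv\<close>, and the coefficient of $x^{-i}$ is \<open>fls_nth f i\<close>.
\<close>

definition poly_to_laurent :: "'b::prime_card mod_ring poly \<Rightarrow> 'b mod_ring fls" where
  "poly_to_laurent g = poly (map_poly fls_const g) fls_X_inv"

text \<open>Coefficients before the leading index vanish, so the sum may always start at 1.\<close>

definition laurent_trunc :: "nat \<Rightarrow> 'b::prime_card mod_ring fls \<Rightarrow> real" where
  "laurent_trunc m f =
     (\<Sum>i=1..m. of_int (to_int_mod_ring (fls_nth f (int i))) / real CARD('b) ^ i)"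

definition lattice_point ::
  "nat \<Rightarrow> nat \<Rightarrow> 'b::prime_card mod_ring poly \<Rightarrow> (nat \<Rightarrow> 'b mod_ring poly)
     \<Rightarrow> 'b mod_ring poly \<Rightarrow> nat \<Rightarrow> real" where
  "lattice_point s m p q n =
     (\<lambda>j\<in>{1..s}. laurent_trunc m (poly_to_laurent (n * q j) / poly_to_laurent p))"

definition lattice_points ::
  "nat \<Rightarrow> nat \<Rightarrow> 'b::prime_card mod_ring poly \<Rightarrow> (nat \<Rightarrow> 'b mod_ring poly)
     \<Rightarrow> (nat \<Rightarrow> real) multiset" where
  "lattice_points s m p q = image_mset (lattice_point s m p q) (mset_set (polys_below m))"


subsection \<open>Weighted star discrepancy\<close>

definition proj_points :: "nat set \<Rightarrow> (nat \<Rightarrow> real) multiset \<Rightarrow> (nat \<Rightarrow> real) multiset" where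
  "proj_points u P = image_mset (\<lambda>x. restrict x u) P"

definition local_discrepancy ::
  "nat set \<Rightarrow> (nat \<Rightarrow> real) multiset \<Rightarrow> (nat \<Rightarrow> real) \<Rightarrow> real" where
  "local_discrepancy u Q y =
     (\<Sum>x\<in>#Q. indicator (PiE u (\<lambda>j. {0..<y j})) x) / real (size Q) - (\<Prod>j\<in>u. y j)"

definition weighted_star_discrepancy ::
  "nat \<Rightarrow> (nat set \<Rightarrow> real) \<Rightarrow> (nat \<Rightarrow> real) multiset \<Rightarrow> real" where
  "weighted_star_discrepancy s \<gamma> P =
     Max ((\<lambda>u. \<gamma> u * (SUP y\<in>PiE u (\<lambda>_. {0..<1}). \<bar>local_discrepancy u (proj_points u P) y\<bar>))
            ` nonempty_subsets s)"


subsection \<open>The figure of merit\<close>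

definition digit :: "nat \<Rightarrow> nat \<Rightarrow> nat \<Rightarrow> nat" where
  "digit b k i = k div b ^ i mod b"

definition trunc_poly :: "nat \<Rightarrow> nat \<Rightarrow> 'b::prime_card mod_ring poly" where
  "trunc_poly m k = (\<Sum>i<m. Polynomial.monom (of_nat (digit CARD('b) k i)) i)"

text \<open>Only meaningful for positive \<open>k\<close>.\<close>

definition num_digits :: "nat \<Rightarrow> nat \<Rightarrow> nat" where
  "num_digits b k = Suc (Max {i. digit b k i \<noteq> 0})"

definition num_digits_vec :: "nat \<Rightarrow> nat set \<Rightarrow> (nat \<Rightarrow> nat) \<Rightarrow> nat" where
  "num_digits_vec b u k = (\<Sum>j\<in>u. num_digits b (k j))"

definition merit_weight ::
  "nat \<Rightarrow> real \<Rightarrow> (nat set \<Rightarrow> real) \<Rightarrow> nat set \<Rightarrow> (nat \<Rightarrow> nat) \<Rightarrow> real" where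
  "merit_weight b \<alpha> \<gamma> u k = \<gamma> u * real b powr (- 2 * \<alpha> * real (num_digits_vec b u k))"

definition dual_net ::
  "nat \<Rightarrow> 'b::prime_card mod_ring poly \<Rightarrow> (nat \<Rightarrow> 'b mod_ring poly) \<Rightarrow> nat set
     \<Rightarrow> (nat \<Rightarrow> nat) set" where
  "dual_net m p q u =
     {k \<in> PiE u (\<lambda>_. {1..}). [(\<Sum>j\<in>u. trunc_poly m (k j) * q j) = 0] (mod p)}"

text \<open>
  The dual net is infinite, so its maximum is written as a supremum; it is attained, see
  \<open>merit_weight_Sup_attained\<close> below.
\<close>

definition figure_of_merit ::
  "nat \<Rightarrow> nat \<Rightarrow> real \<Rightarrow> (nat set \<Rightarrow> real) \<Rightarrow> 'b::prime_card mod_ring poly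
     \<Rightarrow> (nat \<Rightarrow> 'b mod_ring poly) \<Rightarrow> real" where
  "figure_of_merit s m \<alpha> \<gamma> p q =
     Max ((\<lambda>u. SUP k\<in>dual_net m p q u. merit_weight CARD('b) \<alpha> \<gamma> u k) ` nonempty_subsets s)"

definition k_const :: "nat \<Rightarrow> real" where
  "k_const b = (if b = 2 then 1 else 1 + 1 / sin (pi / real b))"


subsection \<open>Well-definedness\<close>

lemma finite_nonempty_subsets: "finite (nonempty_subsets s)"
  by (simp add: nonempty_subsets_def)

lemma polys_below_conv_lists:
  assumes "m \<ge> 1"
  shows "bij_betw Poly {xs :: 'b::prime_card mod_ring list. set xs \<subseteq> UNIV \<and> length xs = m}
           (polys_below m)"
proof (rule bij_betw_imageI)
  show "inj_on Poly {xs :: 'b mod_ring list. set xs \<subseteq> UNIV \<and> length xs = m}"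
  proof (rule inj_onI)
    fix xs ys :: "'b mod_ring list"
    assume "xs \<in> {xs. set xs \<subseteq> UNIV \<and> length xs = m}" "ys \<in> {xs. set xs \<subseteq> UNIV \<and> length xs = m}"
      and eq: "Poly xs = Poly ys"
    then have len: "length xs = m" "length ys = m" by auto
    show "xs = ys"
    proof (rule nth_equalityI)
      fix i assume i: "i < length xs"
      have "Polynomial.coeff (Poly xs) i = Polynomial.coeff (Poly ys) i" using eq by simp
      then show "xs ! i = ys ! i" using i len by (simp add: coeff_Poly_eq nth_default_def)
    qed (use len in simp)
  qed
next
  show "Poly ` {xs :: 'b mod_ring list. set xs \<subseteq> UNIV \<and> length xs = m} = polys_below m"
  proof (rule equalityI; rule subsetI)
    fix g :: "'b mod_ring poly"
    assume "g \<in> Poly ` {xs. set xs \<subseteq> UNIV \<and> length xs = m}"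
    then obtain xs where xs: "g = Poly xs" "length xs = m" by auto
    have "Polynomial.degree g \<le> m - 1"
    proof (rule Polynomial.degree_le, intro allI impI)
      fix i assume "m - 1 < i"
      then show "Polynomial.coeff g i = 0" using xs by (simp add: coeff_Poly_eq nth_default_def)
    qed
    then show "g \<in> polys_below m" using assms by (auto simp: polys_below_def)
  next
    fix g :: "'b mod_ring poly"
    assume "g \<in> polys_below m"
    then have deg: "Polynomial.degree g < m" using assms by (auto simp: polys_below_def)
    have "g = Poly (map (Polynomial.coeff g) [0..<m])"
      by (rule poly_eqI) (use deg in \<open>auto simp: coeff_Poly_eq nth_default_def coeff_eq_0\<close>)
    then show "g \<in> Poly ` {xs. set xs \<subseteq> UNIV \<and> length xs = m}"
      by (intro image_eqI[where x = "map (Polynomial.coeff g) [0..<m]"]) auto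
  qed
qed

lemma card_polys_below:
  assumes "m \<ge> 1"
  shows "finite (polys_below m :: 'b::prime_card mod_ring poly set)"
    and "card (polys_below m :: 'b mod_ring poly set) = CARD('b) ^ m"
proof -
  note bij = polys_below_conv_lists[OF assms, where ?'b = 'b]
  have "finite {xs :: 'b mod_ring list. set xs \<subseteq> UNIV \<and> length xs = m}"
    by (rule finite_lists_length_eq) simp
  with bij show "finite (polys_below m :: 'b mod_ring poly set)"
    using bij_betw_finite by blast
  show "card (polys_below m :: 'b mod_ring poly set) = CARD('b) ^ m"
    using bij_betw_same_card[OF bij] card_lists_length_eq[of "UNIV :: 'b mod_ring set" m] by simp
qed

lemma size_lattice_points:
  fixes p :: "'b::prime_card mod_ring poly"
  assumes "m \<ge> 1"
  shows "size (lattice_points s m p q) = CARD('b) ^ m"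
  using card_polys_below[OF assms, where ?'b = 'b] by (simp add: lattice_points_def)

lemma num_digits_bounds:
  assumes "b \<ge> 2" "k \<ge> 1"
  shows "b ^ (num_digits b k - 1) \<le> k" and "k < b ^ num_digits b k"
proof -
  let ?S = "{i. digit b k i \<noteq> 0}"
  have bound: "i < k" if "i \<in> ?S" for i
  proof (rule ccontr)
    assume "\<not> i < k"
    then have "k < b ^ i"
      using assms power_gt_expt[of b i] by linarith
    then show False using that by (simp add: digit_def)
  qed
  then have fin: "finite ?S" by (meson finite_nat_set_iff_bounded)
  define f where "f = floorlog b k"
  have f: "b ^ (f - 1) \<le> k" "k < b ^ f"
    unfolding f_def using floorlog_bounds[of k b] assms by auto
  have f1: "f \<ge> 1" using f(2) assms by (cases f) auto
  have pw: "b ^ f = b * b ^ (f - 1)" using f1 by (cases f) auto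
  have "k div b ^ (f - 1) < b"
    using f(2) pw assms by (simp add: less_mult_imp_div_less)
  moreover have "k div b ^ (f - 1) > 0"
    using f(1) assms by (simp add: div_greater_zero_iff)
  ultimately have "f - 1 \<in> ?S" by (simp add: digit_def)
  moreover have "i \<le> f - 1" if "i \<in> ?S" for i
  proof (rule ccontr)
    assume "\<not> i \<le> f - 1"
    then have "b ^ f \<le> b ^ i" using assms by (intro power_increasing) auto
    then have "k < b ^ i" using f(2) by linarith
    then show False using that by (simp add: digit_def)
  qed
  ultimately have "Max ?S = f - 1" using fin by (intro Max_eqI) auto
  then have "num_digits b k = f" using f1 by (simp add: num_digits_def)
  with f show "b ^ (num_digits b k - 1) \<le> k" "k < b ^ num_digits b k" by simp_all
qed

lemma dual_net_nonempty: "dual_net m p q u \<noteq> {}" for p :: "'b::prime_card mod_ring poly"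
proof -
  have dig: "digit CARD('b) (CARD('b) ^ m) i = 0" if "i < m" for i
  proof -
    have "CARD('b) ^ m = CARD('b) ^ i * CARD('b) ^ (m - i)"
      using that by (simp flip: power_add)
    then have "CARD('b) ^ m div CARD('b) ^ i = CARD('b) ^ (m - i)" by simp
    then show ?thesis using that by (simp add: digit_def mod_eq_0_iff_dvd)
  qed
  have "trunc_poly m (CARD('b) ^ m) = (0 :: 'b mod_ring poly)"
    by (simp add: trunc_poly_def dig)
  then have "(\<lambda>j\<in>u. CARD('b) ^ m) \<in> dual_net m p q u"
    by (simp add: dual_net_def cong_def Suc_le_eq)
  then show ?thesis by auto
qed

lemma merit_weight_Sup_attained:
  fixes p :: "'b::prime_card mod_ring poly"
  assumes "\<alpha> > 0" "\<gamma> u \<ge> 0"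
  obtains k where "k \<in> dual_net m p q u"
    and "\<And>k'. k' \<in> dual_net m p q u \<Longrightarrow>
           merit_weight CARD('b) \<alpha> \<gamma> u k' \<le> merit_weight CARD('b) \<alpha> \<gamma> u k"
    and "(SUP k\<in>dual_net m p q u. merit_weight CARD('b) \<alpha> \<gamma> u k) =
           merit_weight CARD('b) \<alpha> \<gamma> u k"
proof -
  let ?r = "merit_weight CARD('b) \<alpha> \<gamma> u"
  let ?S = "dual_net m p q u"
  obtain k where k: "k \<in> ?S"
    and least: "\<And>k'. k' \<in> ?S \<Longrightarrow> num_digits_vec CARD('b) u k \<le> num_digits_vec CARD('b) u k'"
    using dual_net_nonempty[of m p q u]
      ex_has_least_nat[of "\<lambda>k. k \<in> ?S" _ "num_digits_vec CARD('b) u"] by blast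
  have le: "?r k' \<le> ?r k" if "k' \<in> ?S" for k'
    using least[OF that] assms
    by (auto simp: merit_weight_def Suc_le_eq intro!: mult_left_mono powr_mono)
  have "(SUP k\<in>?S. ?r k) = ?r k"
    by (rule cSup_eq_maximum) (use k le in auto)
  with k le show ?thesis using that by blast
qed

end

theory Submission
  imports Defs
begin

text \<open>
  Rounding the corner of a box up to the grid of multiples of $1/N$ does not change the number of
  points it contains and costs at most $1-(1-1/N)^{|u|}$ in volume. At a grid corner, the indicator
  of each coordinate interval has a finite Walsh expansion whose coefficient at $k$ is at most
  $k_b b^{-\mu(k)}$; summing over the point set leaves exactly the dual vectors, the zero vector
  accounting for the volume. The dual vectors form a vector space over $\mathbb{F}_b$, so if
  $\delta$ is the least length of a nonzero one, at most $(b-1)b^{|a|-\delta}$ of them have the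
  component-wise lengths $a$, and each of the $(m+1)^{|u|}$ choices of $a$ contributes at most
  $(b-1)b^{-\delta}k_b^{|u|}$. Finally $b^{-\delta}$ is bounded through the figure of merit, using
  monotonicity of the weights for vectors with zero components.
\<close>

section \<open>Additive characters\<close>

text \<open>Everything reduces to the finite group of polynomials of degree below \<open>m\<close>.
  Coordinates of lattice points and of rounded corners have the form \<open>X / b^m\<close> with
  integer \<open>X\<close>, and frequencies are kept as polynomials because duality and bounds on
  length are linear conditions on them. A frequency and \<open>X\<close> are paired through the
  coefficient of \<open>x^(m-1)\<close> in their product. Since the leading digit of
  \<open>X / b^m\<close> is the coefficient of \<open>1/x\<close> of the truncated series, this
  pairing becomes, at a lattice point, the coefficient of \<open>1/x\<close> in
  \<open>h n q / p\<close>. Such coefficients add up over the coordinates, so a product of Walsh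
  functions is a single character of \<open>n\<close>, trivial exactly when \<open>p\<close> divides
  the combination of the \<open>q j\<close>. Integers return only when the figure of merit is
  applied. The zero frequency is given length 0 and is charged the same constant \<open>k_b\<close>
  as the others; the lengths then run over \<open>0..m\<close>, which is where
  \<open>k_b (m+1)\<close> per coordinate comes from.\<close>

definition add_char :: "'b::prime_card mod_ring \<Rightarrow> complex" where
  "add_char a = cis (2 * pi * of_int (to_int_mod_ring a) / real CARD('b))"

lemma to_int_mod_ring_of_int:
  "to_int_mod_ring (of_int k :: 'b::prime_card mod_ring) = k mod int CARD('b)"
  unfolding of_int_of_int_mod_ring by transfer simp

lemma to_int_mod_ring_of_nat:
  "n < CARD('b) \<Longrightarrow> to_int_mod_ring (of_nat n :: 'b::prime_card mod_ring) = int n"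
  using to_int_mod_ring_of_int[of "int n", where ?'b = 'b] by simp

lemma to_int_mod_ring_range:
  fixes a :: "'b::prime_card mod_ring"
  shows "0 \<le> to_int_mod_ring a" "to_int_mod_ring a < int CARD('b)"
  using range_to_int_mod_ring[where ?'a = 'b] by (metis atLeastLessThan_iff rangeI)+

lemma of_int_to_int_mod_ring: "of_int (to_int_mod_ring a) = (a :: 'b::prime_card mod_ring)"
  by (simp add: of_int_of_int_mod_ring)

lemma add_char_of_int:
  "add_char (of_int k :: 'b::prime_card mod_ring) = cis (2 * pi * of_int k / real CARD('b))"
proof -
  let ?b = "int CARD('b)"
  have b: "real CARD('b) > 0" by simp
  have "real_of_int k = of_int (k div ?b) * real CARD('b) + of_int (k mod ?b)"
    by (metis div_mult_mod_eq of_int_add of_int_mult of_int_of_nat_eq)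
  then have "2 * pi * of_int k / real CARD('b) =
      2 * pi * of_int (k div ?b) + 2 * pi * of_int (k mod ?b) / real CARD('b)"
    using b by (simp add: field_simps)
  then have "cis (2 * pi * of_int k / real CARD('b)) =
      cis (2 * pi * of_int (k div ?b)) * cis (2 * pi * of_int (k mod ?b) / real CARD('b))"
    by (simp only: cis_mult)
  also have "cis (2 * pi * of_int (k div ?b)) = 1"
    by (rule cis_multiple_2pi) simp
  finally show ?thesis
    unfolding add_char_def to_int_mod_ring_of_int by simp
qed

lemma add_char_add: "add_char (a + c) = add_char a * add_char (c :: 'b::prime_card mod_ring)"
proof -
  have "add_char (a + c) = add_char (of_int (to_int_mod_ring a + to_int_mod_ring c) :: 'b mod_ring)"
    by (simp add: of_int_to_int_mod_ring)
  also have "\<dots> = add_char a * add_char c"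
    by (subst add_char_of_int) (simp add: add_char_def cis_mult add_divide_distrib distrib_left)
  finally show ?thesis .
qed

lemma add_char_0 [simp]: "add_char 0 = 1"
  by (simp add: add_char_def)

lemma norm_add_char [simp]: "norm (add_char a) = 1"
  by (simp add: add_char_def)

lemma add_char_sum: "add_char (\<Sum>i\<in>A. f i) = (\<Prod>i\<in>A. add_char (f i))"
  by (induction A rule: infinite_finite_induct) (simp_all add: add_char_add)

lemma add_char_mult_of_nat: "add_char (a * of_nat n) = add_char a ^ n"
  by (induction n) (simp_all add: add_char_add distrib_left)

lemma add_char_eq_1_iff [simp]: "add_char (a :: 'b::prime_card mod_ring) = 1 \<longleftrightarrow> a = 0"
proof
  assume "add_char a = 1"
  then have "cos (2 * pi * of_int (to_int_mod_ring a) / real CARD('b)) = 1"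
    unfolding add_char_def by (metis cis.sel(1) one_complex.sel(1))
  then obtain k :: int where "2 * pi * of_int (to_int_mod_ring a) / real CARD('b) = k * 2 * pi"
    by (auto simp: cos_one_2pi_int)
  then have "real_of_int (to_int_mod_ring a) = of_int (k * int CARD('b))"
    by (simp add: field_simps)
  then have eq: "to_int_mod_ring a = k * int CARD('b)" by linarith
  then have "to_int_mod_ring a mod int CARD('b) = 0" by simp
  then have "to_int_mod_ring a = 0"
    using to_int_mod_ring_range[of a] by (simp add: mod_pos_pos_trivial)
  then show "a = 0" by (metis of_int_0 of_int_to_int_mod_ring)
qed simp

text \<open>Translation by \<open>v0\<close> permutes the finite set \<open>V\<close> and multiplies
  the sum by \<open>add_char (L v0)\<close>, which is not 1. This orthogonality relation serves
  twice: for sums over frequencies and for sums over lattice points.\<close>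

lemma sum_add_char_additive:
  fixes L :: "'v::ab_group_add \<Rightarrow> 'b::prime_card mod_ring"
  assumes fin: "finite V" and closed: "\<And>v w. v \<in> V \<Longrightarrow> w \<in> V \<Longrightarrow> v + w \<in> V"
    and additive: "\<And>v w. L (v + w) = L v + L w"
    and v0: "v0 \<in> V" "L v0 \<noteq> 0"
  shows "(\<Sum>v\<in>V. add_char (L v)) = 0"
proof -
  have inj: "inj_on ((+) v0) V" by simp
  have "(+) v0 ` V = V"
    using endo_inj_surj[OF fin _ inj] closed v0 by auto
  then have "(\<Sum>v\<in>V. add_char (L v)) = (\<Sum>v\<in>(+) v0 ` V. add_char (L v))" by simp
  also have "\<dots> = add_char (L v0) * (\<Sum>v\<in>V. add_char (L v))"
    by (subst sum.reindex[OF inj]) (simp add: additive add_char_add sum_distrib_left)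
  finally show ?thesis using v0 by (metis add_char_eq_1_iff mult_cancel_right1)
qed

text \<open>The chord from 1 to the root of unity of angle \<open>2 x t\<close> has length
  \<open>2 |sin (x t)|\<close>, where \<open>x = pi / b\<close>; among the nontrivial roots, the
  neighbours of 1 are the closest.\<close>

lemma norm_add_char_diff_1:
  fixes a :: "'b::prime_card mod_ring"
  assumes "a \<noteq> 0"
  shows "norm (add_char a - 1) \<ge> 2 * sin (pi / real CARD('b))"
proof -
  define t where "t = to_int_mod_ring a"
  have "t \<noteq> 0" using assms unfolding t_def by (metis of_int_0 of_int_to_int_mod_ring)
  then have t: "1 \<le> t" "t \<le> int CARD('b) - 1"
    using to_int_mod_ring_range[of a] unfolding t_def by linarith+
  define x where "x = pi / real CARD('b)"
  have b: "real CARD('b) \<ge> 2"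
    using prime_ge_2_nat[OF prime_card[where ?'a = 'b]] by linarith
  have x: "0 < x" "x \<le> pi / 2" "x * real CARD('b) = pi"
    using b by (auto simp: x_def field_simps)
  have "norm (add_char a - 1) = norm (exp (\<i> * of_real (2 * pi * t / real CARD('b))) - 1)"
    by (simp add: add_char_def cis_conv_exp t_def)
  also have "\<dots> = 2 * \<bar>sin (x * t)\<bar>"
    unfolding dist_exp_i_1 by (simp add: x_def)
  finally have eq: "norm (add_char a - 1) = 2 * \<bar>sin (x * t)\<bar>" .
  \<comment> \<open>Here \<open>x t\<close> lies between \<open>x\<close> and \<open>pi - x\<close>.
    The sine increases up to \<open>pi / 2\<close>, and beyond that point reflection to
    \<open>pi - x t\<close> reduces to the same monotonicity.\<close>
  have "sin x \<le> sin (x * t)"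
  proof (cases "x * t \<le> pi / 2")
    case True
    then show ?thesis using x t by (intro sin_monotone_2pi_le) (auto simp: mult_le_cancel_left1)
  next
    case False
    have "sin x \<le> sin (pi - x * t)"
    proof (rule sin_monotone_2pi_le)
      have "x * t \<le> x * (real CARD('b) - 1)"
        using t x by (intro mult_left_mono) auto
      then show "x \<le> pi - x * t" using x by (simp add: algebra_simps)
    qed (use x False in auto)
    then show ?thesis by simp
  qed
  then show ?thesis using eq unfolding x_def by linarith
qed

text \<open>In the closed form of the geometric sum the numerator has norm at most 2 and the
  denominator is a chord. This is the origin of \<open>1 / sin (pi / b)\<close> in
  \<open>k_b\<close>.\<close>

lemma norm_sum_powers_add_char:
  fixes a :: "'b::prime_card mod_ring"
  assumes "a \<noteq> 0"
  shows "norm (\<Sum>d<t. add_char a ^ d) \<le> 1 / sin (pi / real CARD('b))"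
proof -
  have b: "real CARD('b) \<ge> 2"
    using prime_ge_2_nat[OF prime_card[where ?'a = 'b]] by linarith
  have pos: "sin (pi / real CARD('b)) > 0"
    by (rule sin_gt_zero) (use b in \<open>auto simp: field_simps\<close>)
  note lower = norm_add_char_diff_1[OF assms]
  have "norm (\<Sum>d<t. add_char a ^ d) = norm (add_char a ^ t - 1) / norm (add_char a - 1)"
    using geometric_sum[of "add_char a" t] assms by (simp add: norm_divide)
  also have "\<dots> \<le> 2 / (2 * sin (pi / real CARD('b)))"
  proof (rule frac_le)
    show "norm (add_char a ^ t - 1) \<le> 2"
      using norm_triangle_ineq4[of "add_char a ^ t" 1] by (simp add: norm_power)
  qed (use lower pos in auto)
  finally show ?thesis by simp
qed

lemma sum_powers_add_char_eq_0:
  fixes a :: "'b::prime_card mod_ring"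
  assumes "a \<noteq> 0"
  shows "(\<Sum>d<CARD('b). add_char a ^ d) = 0"
proof -
  have "add_char a ^ CARD('b) = 1"
    using add_char_mult_of_nat[of a "CARD('b)"] by simp
  then show ?thesis using geometric_sum[of "add_char a" "CARD('b)"] assms by simp
qed

section \<open>Digits\<close>

lemma digit_0: "digit b k 0 = k mod b"
  by (simp add: digit_def)

lemma digit_Suc: "digit b k (Suc i) = digit b (k div b) i"
  by (simp add: digit_def div_mult2_eq)

lemma digit_sum:
  assumes "\<And>i. i < m \<Longrightarrow> f i < b"
  shows "digit b (\<Sum>i<m. f i * b ^ i) i = (if i < m then f i else 0)"
  using assms
proof (induction m arbitrary: f i)
  case 0
  then show ?case by (simp add: digit_def)
next
  case (Suc m)
  have eq: "(\<Sum>i<Suc m. f i * b ^ i) = f 0 + b * (\<Sum>i<m. f (Suc i) * b ^ i)"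
    by (subst sum.lessThan_Suc_shift) (simp add: sum_distrib_left mult_ac)
  have f0: "f 0 < b" using Suc.prems by simp
  show ?case
  proof (cases i)
    case 0
    then show ?thesis unfolding eq using f0 by (simp add: digit_0)
  next
    case (Suc j)
    have "(f 0 + b * (\<Sum>i<m. f (Suc i) * b ^ i)) div b = (\<Sum>i<m. f (Suc i) * b ^ i)"
      using f0 by simp
    then show ?thesis unfolding eq Suc digit_Suc using Suc.IH[of "\<lambda>i. f (Suc i)" j] Suc.prems
      by simp
  qed
qed

lemma sum_digits_less:
  fixes f :: "nat \<Rightarrow> nat"
  assumes "\<And>i. i < m \<Longrightarrow> f i < b"
  shows "(\<Sum>i<m. f i * b ^ i) < b ^ m"
  using assms
proof (induction m)
  case (Suc m)
  have "f m * b ^ m + b ^ m \<le> b * b ^ m"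
    using Suc.prems[of m] by (metis Suc_leI add.commute lessI mult_Suc mult_le_mono1)
  moreover have "(\<Sum>i<m. f i * b ^ i) < b ^ m"
    using Suc by simp
  ultimately show ?case by simp
qed simp

lemma sum_digit:
  assumes "k < b ^ m"
  shows "(\<Sum>i<m. digit b k i * b ^ i) = k"
  using assms
proof (induction m arbitrary: k)
  case (Suc m)
  have "k div b < b ^ m" using Suc.prems by (simp add: less_mult_imp_div_less mult.commute)
  then have "(\<Sum>i<m. digit b (k div b) i * b ^ i) = k div b" by (rule Suc.IH)
  moreover have "(\<Sum>i<Suc m. digit b k i * b ^ i)
      = k mod b + b * (\<Sum>i<m. digit b (k div b) i * b ^ i)"
    by (subst sum.lessThan_Suc_shift) (simp add: digit_0 digit_Suc sum_distrib_left mult_ac)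
  ultimately show ?case by simp
qed simp

section \<open>Passing between integers and polynomials over the finite field\<close>

lemma coeff_trunc_poly:
  "poly.coeff (trunc_poly m k :: 'b::prime_card mod_ring poly) i =
     (if i < m then of_nat (digit CARD('b) k i) else 0)"
  by (simp add: trunc_poly_def coeff_sum coeff_monom)

lemma polys_below_iff_coeff:
  "g \<in> polys_below m \<longleftrightarrow> (\<forall>i\<ge>m. poly.coeff g i = 0)"
proof
  assume g: "\<forall>i\<ge>m. poly.coeff g i = 0"
  show "g \<in> polys_below m"
  proof (cases "g = 0")
    case False
    then have "poly.coeff g (degree g) \<noteq> 0" by simp
    then have "degree g < m" using g by (meson not_le)
    then show ?thesis by (simp add: polys_below_def)
  qed (simp add: polys_below_def)
qed (auto simp: polys_below_def coeff_eq_0)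

lemma bij_betw_trunc_poly:
  assumes "m \<ge> 1"
  shows "bij_betw (trunc_poly m) {..<CARD('b) ^ m} (polys_below m :: 'b::prime_card mod_ring poly set)"
proof -
  let ?t = "trunc_poly m :: nat \<Rightarrow> 'b mod_ring poly"
  have inj: "inj_on ?t {..<CARD('b) ^ m}"
  proof (rule inj_onI)
    fix k l assume kl: "k \<in> {..<CARD('b) ^ m}" "l \<in> {..<CARD('b) ^ m}" and eq: "?t k = ?t l"
    have "digit CARD('b) k i = digit CARD('b) l i" if "i < m" for i
    proof -
      have "(of_nat (digit CARD('b) k i) :: 'b mod_ring) = of_nat (digit CARD('b) l i)"
        using arg_cong[OF eq, of "\<lambda>g. poly.coeff g i"] that by (simp add: coeff_trunc_poly)
      moreover have "digit CARD('b) k i < CARD('b)" "digit CARD('b) l i < CARD('b)"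
        by (simp_all add: digit_def)
      ultimately show ?thesis
        by (metis of_nat_eq_iff to_int_mod_ring_of_nat)
    qed
    then have "(\<Sum>i<m. digit CARD('b) k i * CARD('b) ^ i) = (\<Sum>i<m. digit CARD('b) l i * CARD('b) ^ i)"
      by simp
    then show "k = l" using kl by (simp add: sum_digit)
  qed
  moreover have "?t ` {..<CARD('b) ^ m} = polys_below m"
  proof (rule card_subset_eq)
    show "?t ` {..<CARD('b) ^ m} \<subseteq> polys_below m"
      by (auto simp: polys_below_iff_coeff coeff_trunc_poly)
  qed (use card_polys_below[OF assms, where ?'b = 'b] inj in \<open>auto simp: card_image\<close>)
  ultimately show ?thesis by (simp add: bij_betw_def)
qed

text \<open>Inverse of truncation on polynomials of degree below \<open>m\<close>. Summing up to the
  degree makes the code independent of \<open>m\<close>.\<close>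

definition poly_code :: "'b::prime_card mod_ring poly \<Rightarrow> nat" where
  "poly_code h = (\<Sum>i<Suc (degree h). nat (to_int_mod_ring (poly.coeff h i)) * CARD('b) ^ i)"

lemma digit_poly_code:
  fixes h :: "'b::prime_card mod_ring poly"
  shows "digit CARD('b) (poly_code h) i = nat (to_int_mod_ring (poly.coeff h i))"
proof -
  have "nat (to_int_mod_ring (poly.coeff h i)) < CARD('b)" for i
    using to_int_mod_ring_range[of "poly.coeff h i"] by linarith
  then show ?thesis
    unfolding poly_code_def by (subst digit_sum) (auto simp: coeff_eq_0)
qed

lemma of_nat_nat_to_int_mod_ring [simp]:
  "of_nat (nat (to_int_mod_ring a)) = (a :: 'b::prime_card mod_ring)"
  using to_int_mod_ring_range(1)[of a] of_int_to_int_mod_ring[of a]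
  by (metis int_nat_eq of_int_of_nat_eq)

lemma trunc_poly_poly_code:
  "h \<in> polys_below m \<Longrightarrow> trunc_poly m (poly_code h) = h"
  by (rule poly_eqI) (auto simp: coeff_trunc_poly digit_poly_code polys_below_iff_coeff)

lemma digit_poly_code_eq_0_iff:
  fixes h :: "'b::prime_card mod_ring poly"
  shows "digit CARD('b) (poly_code h) i = 0 \<longleftrightarrow> poly.coeff h i = 0"
  unfolding digit_poly_code
  by (metis nat_zero_as_int of_nat_0 of_nat_nat_to_int_mod_ring to_int_mod_ring_hom.hom_zero)

lemma num_digits_poly_code:
  fixes h :: "'b::prime_card mod_ring poly"
  assumes "h \<noteq> 0"
  shows "num_digits CARD('b) (poly_code h) = Suc (degree h)"
proof -
  have "Max {i. poly.coeff h i \<noteq> 0} = degree h"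
    by (rule Max_eqI) (use assms le_degree in \<open>auto intro: finite_subset[of _ "{..degree h}"]\<close>)
  then show ?thesis by (simp add: num_digits_def digit_poly_code_eq_0_iff)
qed

lemma poly_code_pos:
  assumes "h \<noteq> 0"
  shows "poly_code h \<ge> 1"
proof (rule ccontr)
  assume "\<not> poly_code h \<ge> 1"
  then have "poly_code h = 0" by simp
  then have "poly.coeff h (degree h) = 0"
    using digit_poly_code_eq_0_iff[of h "degree h"] by (simp add: digit_def)
  then show False using assms by simp
qed

section \<open>Walsh expansion of the indicator of an interval\<close>

text \<open>The b-adic Walsh function at the point \<open>X / b^m\<close>: coefficient
  \<open>i\<close> of \<open>k\<close> meets digit \<open>m - 1 - i\<close> of \<open>X\<close>,
  which is the digit of \<open>X / b^m\<close> at \<open>b^(-(i+1))\<close>. Writing the pairing as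
  a coefficient of a product makes its bilinearity immediate.\<close>

definition wal :: "nat \<Rightarrow> 'b::prime_card mod_ring poly \<Rightarrow> nat \<Rightarrow> complex" where
  "wal m k X = add_char (poly.coeff (k * trunc_poly m X) (m - 1))"

text \<open>The Fourier coefficient of the indicator of \<open>{0..<c}\<close> on the
  \<open>b^m\<close> grid points; the minus sign is the conjugation of the character.\<close>

definition walsh_coeff :: "nat \<Rightarrow> nat \<Rightarrow> 'b::prime_card mod_ring poly \<Rightarrow> complex" where
  "walsh_coeff m c k =
     (\<Sum>Y<c. add_char (- poly.coeff (k * trunc_poly m Y) (m - 1))) / of_nat CARD('b) ^ m"

lemma polys_below_add: "g \<in> polys_below m \<Longrightarrow> h \<in> polys_below m \<Longrightarrow> g + h \<in> polys_below m"
  by (simp add: polys_below_iff_coeff)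

lemma polys_below_diff: "g \<in> polys_below m \<Longrightarrow> h \<in> polys_below m \<Longrightarrow> g - h \<in> polys_below m"
  by (simp add: polys_below_iff_coeff)

text \<open>The pairing is nondegenerate: a monomial that shifts the leading term of
  \<open>D\<close> to degree \<open>m - 1\<close> pairs with \<open>D\<close> to its leading
  coefficient, so orthogonality applies.\<close>

lemma sum_add_char_coeff_mult:
  fixes D :: "'b::prime_card mod_ring poly"
  assumes m: "m \<ge> 1" and D: "D \<in> polys_below m" "D \<noteq> 0"
  shows "(\<Sum>k\<in>polys_below m. add_char (poly.coeff (k * D) (m - 1))) = 0"
proof (rule sum_add_char_additive)
  have deg: "degree D < m" using D by (simp add: polys_below_def)
  let ?k = "Polynomial.monom 1 (m - 1 - degree D) :: 'b mod_ring poly"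
  show "?k \<in> polys_below m"
    using m by (auto simp: polys_below_iff_coeff coeff_monom)
  show "poly.coeff (?k * D) (m - 1) \<noteq> 0"
    using deg D by (simp add: coeff_monom_mult)
qed (use card_polys_below[OF m] in \<open>auto simp: polys_below_add distrib_right\<close>)

lemma walsh_expansion:
  assumes m: "m \<ge> 1" and X: "X < CARD('b) ^ m" and c: "c \<le> CARD('b) ^ m"
  shows "(\<Sum>k\<in>(polys_below m :: 'b::prime_card mod_ring poly set). walsh_coeff m c k * wal m k X) = of_bool (X < c)"
proof -
  let ?G = "polys_below m :: 'b mod_ring poly set"
  let ?t = "trunc_poly m :: nat \<Rightarrow> 'b mod_ring poly"
  have bij: "bij_betw ?t {..<CARD('b) ^ m} ?G" by (rule bij_betw_trunc_poly[OF m])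
  have inner: "(\<Sum>k\<in>?G. add_char (poly.coeff (k * (?t X - ?t Y)) (m - 1)))
      = (if X = Y then of_nat CARD('b) ^ m else 0)" if Y: "Y < c" for Y
  proof (cases "X = Y")
    case True
    then show ?thesis using card_polys_below[OF m, where ?'b = 'b] by simp
  next
    case False
    have "Y < CARD('b) ^ m" using Y c by simp
    then have "?t X \<noteq> ?t Y" "?t X \<in> ?G" "?t Y \<in> ?G"
      using bij X False by (auto simp: bij_betw_def inj_on_def)
    then show ?thesis
      using False sum_add_char_coeff_mult[OF m, of "?t X - ?t Y"] by (simp add: polys_below_diff)
  qed
  have "(\<Sum>k\<in>?G. walsh_coeff m c k * wal m k X)
      = (\<Sum>k\<in>?G. \<Sum>Y<c. add_char (poly.coeff (k * (?t X - ?t Y)) (m - 1))) / of_nat CARD('b) ^ m"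
    by (simp add: walsh_coeff_def wal_def sum_distrib_right sum_divide_distrib right_diff_distrib
        flip: add_char_add)
  also have "\<dots> = (\<Sum>Y<c. \<Sum>k\<in>?G. add_char (poly.coeff (k * (?t X - ?t Y)) (m - 1))) / of_nat CARD('b) ^ m"
    by (subst sum.swap) simp
  also have "\<dots> = (\<Sum>Y<c. if X = Y then of_nat CARD('b) ^ m else 0) / of_nat CARD('b) ^ m"
    using inner by simp
  also have "\<dots> = of_bool (X < c)" by (simp add: sum.delta)
  finally show ?thesis .
qed

lemma walsh_coeff_0:
  "walsh_coeff m c (0 :: 'b::prime_card mod_ring poly) = of_nat c / of_nat CARD('b) ^ m"
  by (simp add: walsh_coeff_def)

text \<open>
  The sum over each full block of length \<open>B * b\<close> vanishes, so only the block containing \<open>c\<close>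
  contributes.
\<close>

lemma norm_block_sum_le:
  fixes g :: "nat \<Rightarrow> complex" and a :: "'b::prime_card mod_ring"
  assumes a: "a \<noteq> 0" and g: "\<And>X. norm (g X) = 1" and B: "B > 0"
  shows "norm (\<Sum>Y<c. g (Y div (B * CARD('b))) * add_char a ^ (Y div B mod CARD('b)))
           \<le> k_const CARD('b) * real B"
proof -
  define b where "b = CARD('b)"
  have b2: "b \<ge> 2" using prime_ge_2_nat[OF prime_card[where ?'a = 'b]] by (simp add: b_def)
  define f where "f Y = g (Y div (B * b)) * add_char a ^ (Y div B mod b)" for Y
  define C where "C = B * b"
  have C: "C > 0" using B b2 by (simp add: C_def)
  define l where "l = c div C"
  define r where "r = c mod C"
  define t where "t = r div B"
  define e where "e = r mod B"
  \<comment> \<open>\<open>c\<close> consists of \<open>l\<close> full blocks, then \<open>t\<close>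
    full rows of length \<open>B\<close> on which the summand is constant, then \<open>e\<close>
    entries of the next row.\<close>
  have c_eq: "c = l * C + (t * B + e)" by (simp add: l_def r_def t_def e_def)
  have t: "t < b" unfolding t_def r_def C_def using B b2
    by (metis C C_def less_mult_imp_div_less mod_less_divisor mult.commute)
  have e: "e < B" using B by (simp add: e_def)
  have shift: "sum h {n..<n + k} = (\<Sum>i<k. h (n + i))" for h :: "nat \<Rightarrow> complex" and n k
    using sum.shift_bounds_nat_ivl[of h 0 n k] by (simp add: atLeast0LessThan add.commute)
  have val: "f (l' * C + (d * B + i)) = g l' * add_char a ^ d" if "d < b" "i < B" for l' d i
  proof -
    have lt: "d * B + i < C"
    proof -
      have "d * B + i < (d + 1) * B" using that by simp
      also have "\<dots> \<le> b * B" using that by (intro mult_right_mono) auto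
      finally show ?thesis by (simp add: C_def mult.commute)
    qed
    then have 1: "(l' * C + (d * B + i)) div C = l'" using C by simp
    have eq: "l' * C + (d * B + i) = (l' * b + d) * B + i" by (simp add: C_def algebra_simps)
    have "(l' * C + (d * B + i)) div B = l' * b + d" unfolding eq using that B by simp
    then show ?thesis using 1 that by (simp add: f_def C_def)
  qed
  have rows: "sum f {l' * C..<l' * C + k * B} = g l' * of_nat B * (\<Sum>d<k. add_char a ^ d)"
    if "k \<le> b" for l' k
  proof -
    have "sum f {l' * C..<l' * C + k * B} = (\<Sum>i<k * B. f (l' * C + i))" by (rule shift)
    also have "\<dots> = (\<Sum>d<k. \<Sum>i\<in>{d * B..<d * B + B}. f (l' * C + i))"
      by (rule sum.nat_group[symmetric])
    also have "\<dots> = (\<Sum>d<k. \<Sum>i<B. f (l' * C + (d * B + i)))"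
      by (simp only: shift)
    also have "\<dots> = (\<Sum>d<k. of_nat B * (g l' * add_char a ^ d))"
      using val that by (intro sum.cong refl) simp
    finally show ?thesis by (simp add: sum_distrib_left mult_ac)
  qed
  have blocks: "sum f {..<l * C} = 0"
  proof -
    have "sum f {..<l * C} = (\<Sum>l'<l. sum f {l' * C..<l' * C + b * B})"
      using sum.nat_group[of f C l] by (simp add: C_def mult.commute)
    also have "\<dots> = 0"
      using rows sum_powers_add_char_eq_0[OF a] by (simp add: b_def)
    finally show ?thesis .
  qed
  have last: "sum f {l * C + t * B..<l * C + t * B + e} = of_nat e * (g l * add_char a ^ t)"
    unfolding shift using val[OF t] e by (simp add: add.assoc)
  have "sum f {..<c} = sum f {..<l * C} + sum f {l * C..<l * C + t * B}
      + sum f {l * C + t * B..<l * C + t * B + e}"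
    unfolding c_eq
    by (simp add: lessThan_atLeast0 sum.atLeastLessThan_concat add.assoc)
  also have "\<dots> = g l * (of_nat B * (\<Sum>d<t. add_char a ^ d) + of_nat e * add_char a ^ t)"
    using blocks last rows[of t l] t by (simp add: algebra_simps)
  finally have "norm (sum f {..<c})
      = norm (of_nat B * (\<Sum>d<t. add_char a ^ d) + of_nat e * add_char a ^ t)"
    using g by (simp add: norm_mult)
  \<comment> \<open>For \<open>b = 2\<close> consecutive rows have opposite signs, so the remainder
    is \<open>e\<close> or \<open>B - e\<close> in absolute value, at most \<open>B\<close>; the
    triangle inequality would give \<open>k_2 = 2\<close>. For larger \<open>b\<close> the full rows
    account for \<open>1 / sin (pi / b)\<close> and the incomplete row for the summand 1.\<close>
  also have "\<dots> \<le> k_const b * real B"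
  proof (cases "b = 2")
    case True
    have "add_char a ^ 2 = 1" "add_char a \<noteq> 1"
      using a add_char_mult_of_nat[of a b] True of_nat_card_eq_0[where ?'a = 'b] by (auto simp: b_def)
    then have "add_char a = -1" by (simp add: power2_eq_1_iff)
    moreover have "norm (complex_of_nat B - of_nat e) \<le> real B"
      using e by (metis abs_le_iff less_imp_le norm_of_nat of_nat_diff of_nat_mono diff_le_self)
    moreover have "t = 0 \<or> t = 1" using t True by auto
    ultimately show ?thesis using e True by (auto simp: k_const_def)
  next
    case False
    have "norm (of_nat B * (\<Sum>d<t. add_char a ^ d) + of_nat e * add_char a ^ t)
        \<le> real B * norm (\<Sum>d<t. add_char a ^ d) + real e"
      by (rule order.trans[OF norm_triangle_ineq]) (simp add: norm_mult norm_power)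
    also have "\<dots> \<le> real B * (1 / sin (pi / real b)) + real B"
      using e norm_sum_powers_add_char[OF a, of t] unfolding b_def
      by (intro add_mono mult_left_mono) auto
    finally show ?thesis using False by (simp add: k_const_def algebra_simps)
  qed
  finally show ?thesis by (simp add: f_def b_def)
qed

section \<open>Lengths of polynomials and the size of Walsh coefficients\<close>

lemma k_const_ge_1: "k_const CARD('b::prime_card) \<ge> 1"
proof -
  have b: "real CARD('b) \<ge> 2"
    using prime_ge_2_nat[OF prime_card[where ?'a = 'b]] by linarith
  have "sin (pi / real CARD('b)) > 0"
    by (rule sin_gt_zero) (use b in \<open>auto simp: field_simps\<close>)
  then show ?thesis by (simp add: k_const_def)
qed

text \<open>The counterpart of \<open>num_digits\<close> for polynomials, extended by 0 at the zero
  polynomial so that dual vectors with zero components need no separate treatment.\<close>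

definition poly_length :: "'a::zero poly \<Rightarrow> nat" where
  "poly_length h = (if h = 0 then 0 else Suc (degree h))"

lemma poly_length_le_iff: "poly_length h \<le> n \<longleftrightarrow> (\<forall>i\<ge>n. poly.coeff h i = 0)"
proof
  assume *: "\<forall>i\<ge>n. poly.coeff h i = 0"
  show "poly_length h \<le> n"
  proof (cases "h = 0")
    case False
    then have "poly.coeff h (degree h) \<noteq> 0" by simp
    then have "degree h < n" using * by (meson not_le)
    then show ?thesis by (simp add: poly_length_def)
  qed (simp add: poly_length_def)
qed (auto simp: poly_length_def coeff_eq_0 split: if_splits)

lemma poly_length_le_iff_polys_below: "poly_length h \<le> m \<longleftrightarrow> h \<in> polys_below m"
  by (simp add: poly_length_le_iff polys_below_iff_coeff)

text \<open>If \<open>k\<close> has degree \<open>r\<close>, only the digits of \<open>Y\<close> at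
  positions \<open>m - 1 - r\<close> and above enter the pairing. The lowest of them is multiplied
  by the leading coefficient of \<open>k\<close>, which is nonzero, and the higher ones are constant
  on blocks of length \<open>B * b\<close> with \<open>B = b^(m-1-r)\<close>. The block estimate
  then gives \<open>k_b B / b^m = k_b / b^(r+1)\<close>. For \<open>k = 0\<close> the coefficient is
  a proportion, at most \<open>1 \<le> k_b\<close>.\<close>

lemma norm_walsh_coeff_le:
  fixes k :: "'b::prime_card mod_ring poly"
  assumes m: "m \<ge> 1" and k: "k \<in> polys_below m" and c: "c \<le> CARD('b) ^ m"
  shows "norm (walsh_coeff m c k) \<le> k_const CARD('b) / real CARD('b) ^ poly_length k"
proof (cases "k = 0")
  case True
  have "real c \<le> real CARD('b) ^ m"
    using of_nat_mono[OF c, where ?'a = real] by simp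
  then have "real c / real CARD('b) ^ m \<le> 1" by simp
  then have "real c / real CARD('b) ^ m \<le> k_const CARD('b)"
    using k_const_ge_1[where ?'b = 'b] by linarith
  then show ?thesis
    using True
    by (simp add: walsh_coeff_0 poly_length_def norm_divide norm_power)
next
  case False
  define b where "b = CARD('b)"
  define r where "r = degree k"
  define B where "B = b ^ (m - 1 - r)"
  have r: "r < m" using k False by (simp add: polys_below_def r_def)
  have b: "b > 0" by (simp add: b_def)
  have B: "B > 0" using b by (simp add: B_def)
  define a where "a = - poly.coeff k r"
  have a: "a \<noteq> 0" using False by (simp add: a_def r_def)
  define g where "g Z = add_char (- (\<Sum>i<r. poly.coeff k i *
      (of_nat (Z div b ^ (r - 1 - i) mod b) :: 'b mod_ring)))" for Z
  have split: "add_char (- poly.coeff (k * trunc_poly m Y) (m - 1))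
      = g (Y div (B * b)) * add_char a ^ (Y div B mod b)" for Y
  proof -
    have "poly.coeff (k * trunc_poly m Y) (m - 1)
        = (\<Sum>i\<le>m - 1. poly.coeff k i * poly.coeff (trunc_poly m Y) (m - 1 - i))"
      by (rule coeff_mult)
    also have "\<dots> = (\<Sum>i\<le>r. poly.coeff k i * poly.coeff (trunc_poly m Y) (m - 1 - i))"
      using r by (intro sum.mono_neutral_right) (auto simp: r_def intro: coeff_eq_0)
    also have "\<dots> = (\<Sum>i\<le>r. poly.coeff k i * of_nat (digit b Y (m - 1 - i)))"
      using m by (simp add: coeff_trunc_poly b_def)
    also have "\<dots> = (\<Sum>i<r. poly.coeff k i * of_nat (digit b Y (m - 1 - i)))
        + poly.coeff k r * of_nat (digit b Y (m - 1 - r))"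
      by (simp flip: lessThan_Suc_atMost)
    also have "(\<Sum>i<r. poly.coeff k i * of_nat (digit b Y (m - 1 - i)))
       = (\<Sum>i<r. poly.coeff k i * (of_nat (Y div (B * b) div b ^ (r - 1 - i) mod b) :: 'b mod_ring))"
    proof (intro sum.cong refl)
      fix i assume "i \<in> {..<r}"
      then have "(m - 1 - r) + 1 + (r - 1 - i) = m - 1 - i" using r by auto
      then have "B * b * b ^ (r - 1 - i) = b ^ (m - 1 - i)"
        unfolding B_def by (metis power_add power_one_right)
      then show "poly.coeff k i * of_nat (digit b Y (m - 1 - i)) =
          poly.coeff k i * (of_nat (Y div (B * b) div b ^ (r - 1 - i) mod b) :: 'b mod_ring)"
        by (simp add: digit_def flip: div_mult2_eq)
    qed
    finally have eq: "- poly.coeff (k * trunc_poly m Y) (m - 1) =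
        - (\<Sum>i<r. poly.coeff k i * (of_nat (Y div (B * b) div b ^ (r - 1 - i) mod b) :: 'b mod_ring))
        + a * of_nat (Y div B mod b)"
      by (simp add: a_def digit_def B_def)
    show ?thesis unfolding eq add_char_add add_char_mult_of_nat g_def by simp
  qed
  have "norm (\<Sum>Y<c. add_char (- poly.coeff (k * trunc_poly m Y) (m - 1))) \<le> k_const b * real B"
    unfolding split b_def by (rule norm_block_sum_le[OF a]) (use B in \<open>simp_all add: g_def\<close>)
  moreover have "real b ^ m = real B * real b ^ poly_length k"
  proof -
    have "m = (m - 1 - r) + poly_length k" using r False by (simp add: poly_length_def r_def)
    then show ?thesis unfolding B_def by (metis of_nat_power power_add)
  qed
  ultimately show ?thesis
    using B b by (simp add: walsh_coeff_def norm_divide norm_power b_def[symmetric] field_simps)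
qed

section \<open>Laurent series\<close>

lemma poly_to_laurent_nth:
  "fls_nth (poly_to_laurent g) n = (if n \<le> 0 then poly.coeff g (nat (- n)) else 0)"
proof -
  have "poly_to_laurent g = (\<Sum>i\<le>degree g. fls_const (poly.coeff g i) * fls_X_inv ^ i)"
    by (simp add: poly_to_laurent_def poly_altdef coeff_map_poly degree_map_poly)
  then have "fls_nth (poly_to_laurent g) n =
      (\<Sum>i\<le>degree g. if i = nat (- n) \<and> n \<le> 0 then poly.coeff g i else 0)"
    by (auto simp: fls_nth_sum intro!: sum.cong)
  then show ?thesis by (auto simp: sum.delta coeff_eq_0)
qed

lemma poly_to_laurent_0 [simp]: "poly_to_laurent 0 = 0"
  by (simp add: poly_to_laurent_def)

lemma poly_to_laurent_add: "poly_to_laurent (g + h) = poly_to_laurent g + poly_to_laurent h"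
  by (rule fls_eqI) (simp add: poly_to_laurent_nth)

lemma poly_to_laurent_sum: "poly_to_laurent (sum f A) = (\<Sum>i\<in>A. poly_to_laurent (f i))"
  by (induction A rule: infinite_finite_induct) (simp_all add: poly_to_laurent_add)

lemma poly_to_laurent_smult: "poly_to_laurent (Polynomial.smult a g) = fls_const a * poly_to_laurent g"
  by (rule fls_eqI) (simp add: poly_to_laurent_nth)

lemma poly_to_laurent_pCons:
  "poly_to_laurent (pCons a g) = fls_const a + fls_X_inv * poly_to_laurent g"
proof (rule fls_eqI)
  fix n :: int
  show "fls_nth (poly_to_laurent (pCons a g)) n =
      fls_nth (fls_const a + fls_X_inv * poly_to_laurent g) n"
  proof (cases "n < 0")
    case True
    then have "nat (- n) = Suc (nat (- (n + 1)))" by simp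
    then show ?thesis using True
      by (simp add: poly_to_laurent_nth fls_X_inv_times_conv_shift coeff_pCons)
  qed (simp add: poly_to_laurent_nth fls_X_inv_times_conv_shift)
qed

lemma poly_to_laurent_mult: "poly_to_laurent (g * h) = poly_to_laurent g * poly_to_laurent h"
proof (induction g)
  case (pCons a g)
  then show ?case
    by (simp add: poly_to_laurent_add poly_to_laurent_smult poly_to_laurent_pCons distrib_right mult.assoc)
qed simp

lemma poly_to_laurent_times_nth:
  assumes "g \<in> polys_below m"
  shows "fls_nth (poly_to_laurent g * f) n = (\<Sum>i<m. poly.coeff g i * fls_nth f (n + int i))"
proof -
  have "poly_to_laurent g = (\<Sum>i\<le>degree g. fls_const (poly.coeff g i) * fls_X_inv ^ i)"
    by (simp add: poly_to_laurent_def poly_altdef coeff_map_poly degree_map_poly)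
  also have "\<dots> = (\<Sum>i<m. fls_const (poly.coeff g i) * fls_X_inv ^ i)"
  proof (cases "g = 0")
    case False
    then have "degree g < m" using assms by (simp add: polys_below_def)
    then show ?thesis by (intro sum.mono_neutral_left) (auto intro: coeff_eq_0)
  qed simp
  finally show ?thesis
    by (simp add: sum_distrib_right fls_nth_sum mult.assoc fls_X_inv_power_times_conv_shift(1))
qed

lemma poly_to_laurent_eq_0_iff [simp]: "poly_to_laurent g = 0 \<longleftrightarrow> g = 0"
proof
  assume "poly_to_laurent g = 0"
  then have "poly.coeff g i = 0" for i
    using poly_to_laurent_nth[of g "- int i"] by simp
  then show "g = 0" by (simp add: poly_eq_iff)
qed simp

lemma fls_subdegree_poly_to_laurent:
  "fls_subdegree (poly_to_laurent g) = - int (degree g)"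
proof (cases "g = 0")
  case False
  then show ?thesis
    by (intro fls_subdegree_eqI) (auto simp: poly_to_laurent_nth intro!: coeff_eq_0)
qed simp

section \<open>The coefficient of \<open>1/x\<close> in quotients of polynomials\<close>

lemma fls_nth_laurent_quotient_dvd:
  assumes "p \<noteq> 0" "p dvd g"
  shows "fls_nth (poly_to_laurent g / poly_to_laurent p) 1 = 0"
proof -
  obtain d where d: "g = p * d" using assms(2) by blast
  have "poly_to_laurent g / poly_to_laurent p = poly_to_laurent d"
    using assms(1) by (simp add: d poly_to_laurent_mult)
  then show ?thesis by (simp add: poly_to_laurent_nth)
qed

text \<open>Modulo \<open>p\<close> one may replace \<open>g\<close> by its nonzero remainder
  \<open>r\<close>. Multiplying \<open>r\<close> by a monomial raises its degree to
  \<open>m - 1\<close>, one less than that of \<open>p\<close>, so the quotient starts exactly at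
  \<open>1/x\<close>.\<close>

lemma ex_fls_nth_laurent_quotient_nonzero:
  fixes p :: "'b::prime_card mod_ring poly"
  assumes "\<not> p dvd g" and m: "degree p = m" "m \<ge> 1"
  shows "\<exists>n\<in>polys_below m. fls_nth (poly_to_laurent (n * g) / poly_to_laurent p) 1 \<noteq> 0"
proof
  have p: "p \<noteq> 0" using m by auto
  define r where "r = g mod p"
  have r: "r \<noteq> 0" using assms by (simp add: r_def mod_eq_0_iff_dvd)
  then have deg: "degree r < m" using degree_mod_less[OF p, of g] m by (simp add: r_def)
  define n where "n = Polynomial.monom (1 :: 'b mod_ring) (m - 1 - degree r)"
  show "n \<in> polys_below m"
    using m by (auto simp: polys_below_iff_coeff coeff_monom n_def)
  have n: "n \<noteq> 0" by (simp add: n_def)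
  have "degree (n * r) = m - 1 - degree r + degree r"
    using n r by (simp add: degree_mult_eq) (simp add: n_def degree_monom_eq)
  then have nr: "degree (n * r) = m - 1" using deg by simp
  have "n * g = p * (n * (g div p)) + n * r"
    unfolding r_def by (metis div_mult_mod_eq distrib_left mult.assoc mult.commute)
  then have "fls_nth (poly_to_laurent (n * g) / poly_to_laurent p) 1
      = fls_nth (poly_to_laurent (n * r) / poly_to_laurent p) 1"
    using fls_nth_laurent_quotient_dvd[OF p, of "p * (n * (g div p))"]
    by (simp add: poly_to_laurent_add add_divide_distrib)
  moreover have "fls_subdegree (poly_to_laurent (n * r) / poly_to_laurent p) = 1"
    using n r p m nr by (simp add: fls_divide_subdegree fls_subdegree_poly_to_laurent)
  moreover have "poly_to_laurent (n * r) / poly_to_laurent p \<noteq> 0"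
    using n r p by simp
  ultimately show "fls_nth (poly_to_laurent (n * g) / poly_to_laurent p) 1 \<noteq> 0"
    by (metis nth_fls_subdegree_nonzero)
qed

text \<open>The numerator over \<open>b^m\<close> of the truncated series. The order is reversed:
  the coefficient of \<open>1/x\<close> becomes the most significant digit.\<close>

definition point_code :: "nat \<Rightarrow> 'b::prime_card mod_ring fls \<Rightarrow> nat" where
  "point_code m f = (\<Sum>i<m. nat (to_int_mod_ring (fls_nth f (int (m - i)))) * CARD('b) ^ i)"

lemma nat_to_int_mod_ring_less: "nat (to_int_mod_ring a) < CARD('b)" for a :: "'b::prime_card mod_ring"
  using to_int_mod_ring_range[of a] by linarith

lemma point_code_less: "point_code m f < CARD('b) ^ m" for f :: "'b::prime_card mod_ring fls"
  unfolding point_code_def by (rule sum_digits_less) (rule nat_to_int_mod_ring_less)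

lemma laurent_trunc_eq:
  fixes f :: "'b::prime_card mod_ring fls"
  shows "laurent_trunc m f = real (point_code m f) / real CARD('b) ^ m"
proof -
  let ?b = "real CARD('b)"
  let ?t = "\<lambda>i. real_of_int (to_int_mod_ring (fls_nth f (int i)))"
  have "laurent_trunc m f = (\<Sum>i<m. ?t (m - i) / ?b ^ (m - i))"
    unfolding laurent_trunc_def
    by (rule sum.reindex_bij_witness[of _ "\<lambda>i. m - i" "\<lambda>i. m - i"]) auto
  also have "\<dots> = (\<Sum>i<m. ?t (m - i) * ?b ^ i / ?b ^ m)"
  proof (intro sum.cong refl)
    fix i assume "i \<in> {..<m}"
    then have "?b ^ m = ?b ^ (m - i) * ?b ^ i" by (simp flip: power_add)
    then show "?t (m - i) / ?b ^ (m - i) = ?t (m - i) * ?b ^ i / ?b ^ m" by simp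
  qed
  also have "\<dots> = real (point_code m f) / ?b ^ m"
    using to_int_mod_ring_range(1)[where ?'b = 'b] by (simp add: point_code_def sum_divide_distrib)
  finally show ?thesis .
qed

text \<open>The reversal of digits in \<open>point_code\<close> cancels the one built into
  \<open>wal\<close>: coefficient \<open>i\<close> of \<open>h\<close> meets the coefficient of
  \<open>x^(-(i+1))\<close> in \<open>f\<close>, and these products sum to the coefficient of
  \<open>1/x\<close> in \<open>h f\<close>.\<close>

lemma wal_point_code:
  fixes f :: "'b::prime_card mod_ring fls"
  assumes m: "m \<ge> 1" and h: "h \<in> polys_below m"
  shows "wal m h (point_code m f) = add_char (fls_nth (poly_to_laurent h * f) 1)"
proof -
  have "poly.coeff (h * trunc_poly m (point_code m f)) (m - 1)
      = (\<Sum>i\<le>m - 1. poly.coeff h i * poly.coeff (trunc_poly m (point_code m f)) (m - 1 - i))"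
    by (rule coeff_mult)
  also have "\<dots> = (\<Sum>i<m. poly.coeff h i * fls_nth f (1 + int i))"
  proof (rule sum.cong)
    fix i assume i: "i \<in> {..<m}"
    then have "int (m - (m - 1 - i)) = 1 + int i" by auto
    moreover have "digit CARD('b) (point_code m f) (m - 1 - i)
        = nat (to_int_mod_ring (fls_nth f (int (m - (m - 1 - i)))))"
      unfolding point_code_def using i by (subst digit_sum) (auto simp: nat_to_int_mod_ring_less)
    ultimately show "poly.coeff h i * poly.coeff (trunc_poly m (point_code m f)) (m - 1 - i)
        = poly.coeff h i * fls_nth f (1 + int i)"
      using i by (simp add: coeff_trunc_poly)
  qed (use m in auto)
  finally show ?thesis
    by (simp add: wal_def poly_to_laurent_times_nth[OF h])
qed

section \<open>The discrepancy at grid points\<close>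

text \<open>Unlike in \<open>dual_net\<close>, zero components are allowed; this makes the set
  closed under differences.\<close>

definition dual_polys ::
  "nat \<Rightarrow> 'b::prime_card mod_ring poly \<Rightarrow> (nat \<Rightarrow> 'b mod_ring poly) \<Rightarrow> nat set
     \<Rightarrow> (nat \<Rightarrow> 'b mod_ring poly) set" where
  "dual_polys m p q u = {h \<in> PiE u (\<lambda>_. polys_below m). p dvd (\<Sum>j\<in>u. h j * q j)}"

definition point_index ::
  "nat \<Rightarrow> 'b::prime_card mod_ring poly \<Rightarrow> (nat \<Rightarrow> 'b mod_ring poly) \<Rightarrow> 'b mod_ring poly \<Rightarrow> nat \<Rightarrow> nat"
  where "point_index m p q n j = point_code m (poly_to_laurent (n * q j) / poly_to_laurent p)"

text \<open>Multiplying the characters adds the coefficients of \<open>1/x\<close>, so the product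
  is the character of \<open>L n\<close>, which is additive in \<open>n\<close>. It is trivial if
  \<open>p\<close> divides \<open>?Q\<close>; otherwise some \<open>n\<close> has
  \<open>L n \<noteq> 0\<close> and the sum cancels.\<close>

lemma sum_prod_wal:
  fixes p :: "'b::prime_card mod_ring poly"
  assumes m: "degree p = m" "m \<ge> 1" and h: "h \<in> PiE u (\<lambda>_. polys_below m)"
  shows "(\<Sum>n\<in>polys_below m. \<Prod>j\<in>u. wal m (h j) (point_index m p q n j))
           = (if p dvd (\<Sum>j\<in>u. h j * q j) then of_nat CARD('b) ^ m else 0)"
proof -
  let ?Q = "\<Sum>j\<in>u. h j * q j"
  define L where "L n = fls_nth (poly_to_laurent (n * ?Q) / poly_to_laurent p) 1" for n
  have p: "p \<noteq> 0" using m by auto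
  have "(\<Prod>j\<in>u. wal m (h j) (point_index m p q n j)) = add_char (L n)" for n
  proof -
    have "(\<Prod>j\<in>u. wal m (h j) (point_index m p q n j))
        = (\<Prod>j\<in>u. add_char (fls_nth (poly_to_laurent (h j) *
             (poly_to_laurent (n * q j) / poly_to_laurent p)) 1))"
      using h unfolding point_index_def by (intro prod.cong refl wal_point_code[OF m(2)]) auto
    also have "\<dots> = add_char (fls_nth (\<Sum>j\<in>u. poly_to_laurent (h j) *
             (poly_to_laurent (n * q j) / poly_to_laurent p)) 1)"
      by (simp add: add_char_sum fls_nth_sum)
    also have "(\<Sum>j\<in>u. poly_to_laurent (h j) * (poly_to_laurent (n * q j) / poly_to_laurent p))
        = poly_to_laurent (n * ?Q) / poly_to_laurent p"
      by (simp add: sum_distrib_left poly_to_laurent_sum sum_divide_distrib poly_to_laurent_mult mult_ac)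
    finally show ?thesis by (simp add: L_def)
  qed
  then have eq: "(\<Sum>n\<in>polys_below m. \<Prod>j\<in>u. wal m (h j) (point_index m p q n j))
      = (\<Sum>n\<in>polys_below m. add_char (L n))" by simp
  show ?thesis
  proof (cases "p dvd ?Q")
    case True
    then have "L n = 0" for n
      unfolding L_def by (intro fls_nth_laurent_quotient_dvd[OF p]) simp
    then show ?thesis using eq True card_polys_below[OF m(2), where ?'b = 'b] by simp
  next
    case False
    obtain n where n: "n \<in> polys_below m" "L n \<noteq> 0"
      using ex_fls_nth_laurent_quotient_nonzero[OF False m] by (auto simp: L_def)
    have "(\<Sum>n\<in>polys_below m. add_char (L n)) = 0"
    proof (rule sum_add_char_additive)
      show "L (v + w) = L v + L w" for v w
        by (simp add: L_def distrib_right poly_to_laurent_add add_divide_distrib)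
    qed (use n card_polys_below[OF m(2)] polys_below_add in auto)
    then show ?thesis using eq False by simp
  qed
qed

lemma of_real_of_bool: "of_real (of_bool P) = of_bool P"
  by (cases P) simp_all

text \<open>Up to the last estimate this is an identity: the signed discrepancy equals the sum of
  the coefficient products over the nonzero dual vectors. Absolute values are taken only
  afterwards.\<close>

lemma grid_discrepancy_le:
  fixes p :: "'b::prime_card mod_ring poly"
  assumes m: "degree p = m" "m \<ge> 1" and u: "finite u"
    and c: "\<And>j. j \<in> u \<Longrightarrow> c j \<le> CARD('b) ^ m"
  shows "\<bar>(\<Sum>n\<in>polys_below m. \<Prod>j\<in>u. of_bool (point_index m p q n j < c j)) / real CARD('b) ^ m
            - (\<Prod>j\<in>u. real (c j) / real CARD('b) ^ m)\<bar>
         \<le> (\<Sum>h\<in>dual_polys m p q u - {\<lambda>j\<in>u. 0}.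
              \<Prod>j\<in>u. k_const CARD('b) / real CARD('b) ^ poly_length (h j))"
proof -
  let ?G = "polys_below m :: 'b mod_ring poly set"
  let ?N = "of_nat CARD('b) ^ m :: complex"
  let ?D = "dual_polys m p q u"
  let ?w = "\<lambda>h. \<Prod>j\<in>u. walsh_coeff m (c j) (h j :: 'b mod_ring poly)"
  have finG: "finite ?G" by (rule card_polys_below[OF m(2)])
  have finP: "finite (PiE u (\<lambda>_. ?G))" using u finG by (rule finite_PiE)
  have D_sub: "?D \<subseteq> PiE u (\<lambda>_. ?G)" by (auto simp: dual_polys_def)
  have finD: "finite ?D" using D_sub finP by (rule finite_subset)
  have zero: "(\<lambda>j\<in>u. 0) \<in> ?D" by (auto simp: dual_polys_def polys_below_def)
  have "(\<Sum>n\<in>?G. \<Prod>j\<in>u. of_bool (point_index m p q n j < c j))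
      = (\<Sum>n\<in>?G. \<Prod>j\<in>u. \<Sum>k\<in>?G. walsh_coeff m (c j) k * wal m k (point_index m p q n j))"
    using c by (intro sum.cong prod.cong refl)
      (simp add: walsh_expansion[OF m(2)] point_index_def point_code_less)
  also have "\<dots> = (\<Sum>n\<in>?G. \<Sum>h\<in>PiE u (\<lambda>_. ?G).
      \<Prod>j\<in>u. walsh_coeff m (c j) (h j) * wal m (h j) (point_index m p q n j))"
    using u finG by (simp add: prod_sum_PiE)
  also have "\<dots> = (\<Sum>h\<in>PiE u (\<lambda>_. ?G). ?w h *
      (\<Sum>n\<in>?G. \<Prod>j\<in>u. wal m (h j) (point_index m p q n j)))"
    by (subst sum.swap) (simp add: prod.distrib sum_distrib_left)
  also have "\<dots> = (\<Sum>h\<in>PiE u (\<lambda>_. ?G). if h \<in> ?D then ?N * ?w h else 0)"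
    by (intro sum.cong refl) (simp add: sum_prod_wal[OF m] dual_polys_def)
  also have "\<dots> = ?N * (\<Sum>h\<in>?D. ?w h)"
    using D_sub finP by (simp add: sum.If_cases Int_absorb1 sum_distrib_left)
  also have "(\<Sum>h\<in>?D. ?w h) = ?w (\<lambda>j\<in>u. 0) + (\<Sum>h\<in>?D - {\<lambda>j\<in>u. 0}. ?w h)"
    by (rule sum.remove[OF finD zero])
  also have "?w (\<lambda>j\<in>u. 0) = (\<Prod>j\<in>u. of_nat (c j) / ?N)"
    by (simp add: walsh_coeff_0)
  finally have eq: "(\<Sum>n\<in>?G. \<Prod>j\<in>u. of_bool (point_index m p q n j < c j))
      = ?N * ((\<Prod>j\<in>u. of_nat (c j) / ?N) + (\<Sum>h\<in>?D - {\<lambda>j\<in>u. 0}. ?w h))" .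
  have cancel: "x / ?N - y = z" if "x = ?N * (y + z)" for x y z using that by simp
  let ?\<Delta> = "(\<Sum>n\<in>?G. \<Prod>j\<in>u. of_bool (point_index m p q n j < c j)) / real CARD('b) ^ m
      - (\<Prod>j\<in>u. real (c j) / real CARD('b) ^ m)"
  have "complex_of_real ?\<Delta> =
      (\<Sum>n\<in>?G. \<Prod>j\<in>u. of_bool (point_index m p q n j < c j)) / ?N - (\<Prod>j\<in>u. of_nat (c j) / ?N)"
    by (simp add: of_real_of_bool)
  also have "\<dots> = (\<Sum>h\<in>?D - {\<lambda>j\<in>u. 0}. ?w h)"
    by (rule cancel[OF eq])
  finally have "norm (complex_of_real ?\<Delta>) = norm (\<Sum>h\<in>?D - {\<lambda>j\<in>u. 0}. ?w h)"
    by (rule arg_cong)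
  then have "\<bar>?\<Delta>\<bar> = norm (\<Sum>h\<in>?D - {\<lambda>j\<in>u. 0}. ?w h)"
    by (simp only: norm_of_real)
  also have "\<dots> \<le> (\<Sum>h\<in>?D - {\<lambda>j\<in>u. 0}. norm (?w h))"
    by (rule norm_sum)
  also have "\<dots> \<le> (\<Sum>h\<in>?D - {\<lambda>j\<in>u. 0}. \<Prod>j\<in>u. k_const CARD('b) / real CARD('b) ^ poly_length (h j))"
    unfolding prod_norm[symmetric]
    using D_sub c by (intro sum_mono prod_mono conjI norm_walsh_coeff_le[OF m(2)]) auto
  finally show ?thesis .
qed

section \<open>Counting dual polynomials by length\<close>

context
  fixes m :: nat and p :: "'b::prime_card mod_ring poly" and q :: "nat \<Rightarrow> 'b mod_ring poly"
    and u :: "nat set"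
  assumes u: "finite u" and m: "m \<ge> 1"
begin

lemma finite_dual_polys: "finite (dual_polys m p q u)"
proof (rule finite_subset)
  show "dual_polys m p q u \<subseteq> PiE u (\<lambda>_. polys_below m)" by (auto simp: dual_polys_def)
qed (use u card_polys_below[OF m] in \<open>auto intro: finite_PiE\<close>)

lemma dual_polys_diff:
  assumes "g \<in> dual_polys m p q u" "h \<in> dual_polys m p q u"
  shows "(\<lambda>j\<in>u. g j - h j) \<in> dual_polys m p q u"
proof -
  have "(\<Sum>j\<in>u. (\<lambda>j\<in>u. g j - h j) j * q j) = (\<Sum>j\<in>u. g j * q j) - (\<Sum>j\<in>u. h j * q j)"
    by (simp add: left_diff_distrib sum_subtractf)
  then show ?thesis using assms by (auto simp: dual_polys_def dvd_diff intro!: polys_below_diff)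
qed

text \<open>Lengths are bounded rather than prescribed: differences respect upper bounds, but need
  not preserve exact lengths.\<close>

definition dual_below :: "(nat \<Rightarrow> nat) \<Rightarrow> (nat \<Rightarrow> 'b mod_ring poly) set" where
  "dual_below a = {h \<in> dual_polys m p q u. \<forall>j\<in>u. poly_length (h j) \<le> a j}"

lemma finite_dual_below: "finite (dual_below a)"
  using finite_dual_polys by (simp add: dual_below_def)

text \<open>
  Each fibre of \<open>h \<mapsto> coeff (h j) (a j - 1)\<close> is a translate of a subset of the space in
  which the length of the \<open>j\<close>-th component is at most \<open>a j - 1\<close>.
\<close>

lemma card_dual_below_slice:
  assumes j: "j \<in> u" "a j \<ge> 1"
  shows "card {h \<in> dual_below a. poly.coeff (h j) (a j - 1) \<in> C}
           \<le> card C * card (dual_below (a(j := a j - 1)))"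
proof -
  let ?F = "\<lambda>c. {h \<in> dual_below a. poly.coeff (h j) (a j - 1) = c}"
  let ?W = "dual_below (a(j := a j - 1))"
  have fibre: "card (?F c) \<le> card ?W" for c
  proof (cases "?F c = {}")
    case False
    then obtain g where g: "g \<in> ?F c" by blast
    let ?s = "\<lambda>h. \<lambda>i\<in>u. h i - g i"
    show ?thesis
    proof (rule card_inj_on_le)
      show "inj_on ?s (?F c)"
      proof (rule inj_onI)
        fix h h' assume h: "h \<in> ?F c" "h' \<in> ?F c" and eq: "?s h = ?s h'"
        have "h i = h' i" if "i \<in> u" for i using fun_cong[OF eq, of i] that by simp
        then show "h = h'"
          using h by (auto simp: dual_below_def dual_polys_def intro: PiE_ext)
      qed
      show "?s ` ?F c \<subseteq> ?W"
      proof
        fix f assume "f \<in> ?s ` ?F c"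
        then obtain h where h: "h \<in> ?F c" and f: "f = ?s h" by blast
        have "f \<in> dual_polys m p q u"
          unfolding f using h g by (intro dual_polys_diff) (auto simp: dual_below_def)
        moreover have "poly_length (f i) \<le> (a(j := a j - 1)) i" if i: "i \<in> u" for i
        proof -
          have "\<forall>k\<ge>a i. poly.coeff (h i) k = 0 \<and> poly.coeff (g i) k = 0"
            using h g i by (auto simp: dual_below_def poly_length_le_iff)
          \<comment> \<open>Lowering the bound adds the single index \<open>a j - 1\<close>, where
            \<open>h j\<close> and \<open>g j\<close> share the coefficient \<open>c\<close>, so
            their difference vanishes there.\<close>
          moreover have "k \<ge> a j \<or> k = a j - 1" if "k \<ge> a j - 1" for k using that by auto
          ultimately show ?thesis
            using h g i unfolding poly_length_le_iff f by (auto simp del: One_nat_def) metis+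
        qed
        ultimately show "f \<in> ?W" by (auto simp: dual_below_def)
      qed
    qed (rule finite_dual_below)
  next
    case True
    show ?thesis unfolding True by simp
  qed
  have "card {h \<in> dual_below a. poly.coeff (h j) (a j - 1) \<in> C} = card (\<Union>c\<in>C. ?F c)"
    by (rule arg_cong[of _ _ card]) auto
  also have "\<dots> \<le> (\<Sum>c\<in>C. card (?F c))" by (rule card_UN_le) simp
  also have "\<dots> \<le> (\<Sum>c\<in>C. card ?W)" by (intro sum_mono fibre)
  finally show ?thesis by simp
qed

lemma sum_pred_upd:
  assumes "j \<in> u" "(a j :: nat) \<ge> 1"
  shows "sum a u = Suc (sum (a(j := a j - 1)) u)"
  using assms u by (simp add: sum.remove[of u j])

text \<open>Lowering one bound by 1 costs a factor \<open>b\<close>, and once the total is below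
  \<open>\<delta>\<close> only the zero vector can remain. In that final case the truncated
  subtraction makes the exponent 0.\<close>

lemma card_dual_below_le:
  assumes \<delta>: "\<delta> \<ge> 1" "\<And>h. h \<in> dual_polys m p q u - {\<lambda>j\<in>u. 0} \<Longrightarrow> \<delta> \<le> (\<Sum>j\<in>u. poly_length (h j))"
  shows "card (dual_below a) \<le> CARD('b) ^ (Suc (sum a u) - \<delta>)"
proof (induction "sum a u" arbitrary: a rule: less_induct)
  case less
  show ?case
  proof (cases "sum a u < \<delta>")
    case True
    have "h = (\<lambda>j\<in>u. 0)" if h: "h \<in> dual_below a" for h
    proof (rule ccontr)
      assume "h \<noteq> (\<lambda>j\<in>u. 0)"
      then have "\<delta> \<le> (\<Sum>j\<in>u. poly_length (h j))" using h by (intro \<delta>) (auto simp: dual_below_def)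
      also have "\<dots> \<le> sum a u" using h by (intro sum_mono) (auto simp: dual_below_def)
      finally show False using True by simp
    qed
    then have "dual_below a \<subseteq> {\<lambda>j\<in>u. 0}" by auto
    then have "card (dual_below a) \<le> 1"
      using card_mono[of "{\<lambda>j\<in>u. 0 :: 'b mod_ring poly}" "dual_below a"] by simp
    then show ?thesis using True by simp
  next
    case False
    then have "sum a u \<noteq> 0" using \<delta>(1) by simp
    then obtain j where j: "j \<in> u" "a j \<ge> 1" using u by (metis One_nat_def Suc_leI gr0I sum.neutral)
    note decr = sum_pred_upd[of j a, OF j]
    have "card (dual_below a) \<le> CARD('b) * card (dual_below (a(j := a j - 1)))"
      using card_dual_below_slice[of j a UNIV, OF j] by simp
    also have "\<dots> \<le> CARD('b) * CARD('b) ^ (Suc (sum (a(j := a j - 1)) u) - \<delta>)"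
      using decr by (intro mult_left_mono less) auto
    also have "\<dots> = CARD('b) ^ (Suc (sum a u) - \<delta>)"
      using False decr by (simp add: Suc_diff_le flip: power_Suc)
    finally show ?thesis .
  qed
qed

text \<open>Exact lengths force a nonzero leading coefficient in a component with
  \<open>a j \<ge> 1\<close>. The first slice therefore has \<open>b - 1\<close> values instead of
  \<open>b\<close>, which is the origin of the factor \<open>b - 1\<close>; lowering that bound
  absorbs the \<open>Suc\<close> in the exponent.\<close>

lemma card_dual_length_le:
  assumes \<delta>: "\<delta> \<ge> 1" "\<And>h. h \<in> dual_polys m p q u - {\<lambda>j\<in>u. 0} \<Longrightarrow> \<delta> \<le> (\<Sum>j\<in>u. poly_length (h j))"
    and a: "sum a u \<ge> \<delta>"
  shows "card {h \<in> dual_polys m p q u. \<forall>j\<in>u. poly_length (h j) = a j}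
           \<le> (CARD('b) - 1) * CARD('b) ^ (sum a u - \<delta>)"
proof -
  have "sum a u \<noteq> 0" using \<delta>(1) a by simp
  then obtain j where j: "j \<in> u" "a j \<ge> 1" using u by (metis One_nat_def Suc_leI gr0I sum.neutral)
  let ?S = "{h \<in> dual_below a. poly.coeff (h j) (a j - 1) \<in> UNIV - {0}}"
  have "{h \<in> dual_polys m p q u. \<forall>j\<in>u. poly_length (h j) = a j} \<subseteq> ?S"
  proof
    fix h assume h: "h \<in> {h \<in> dual_polys m p q u. \<forall>j\<in>u. poly_length (h j) = a j}"
    then have "a j = poly_length (h j)" using j by auto
    then have "poly.coeff (h j) (a j - 1) \<noteq> 0"
      using j(2) by (auto simp: poly_length_def split: if_splits)
    then show "h \<in> ?S" using h by (simp add: dual_below_def)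
  qed
  then have "card {h \<in> dual_polys m p q u. \<forall>j\<in>u. poly_length (h j) = a j} \<le> card ?S"
    using finite_dual_below by (intro card_mono) auto
  also have "\<dots> \<le> card (UNIV - {0 :: 'b mod_ring}) * card (dual_below (a(j := a j - 1)))"
    using j by (rule card_dual_below_slice)
  also have "\<dots> \<le> (CARD('b) - 1) * CARD('b) ^ (Suc (sum (a(j := a j - 1)) u) - \<delta>)"
    by (intro mult_mono card_dual_below_le \<delta>) (simp_all add: card_Diff_singleton)
  finally show ?thesis using sum_pred_upd[of j a, OF j] by simp
qed

text \<open>On the vectors with component-wise lengths \<open>a\<close> the summand is constantly
  \<open>k_b^|u| b^(-|a|)\<close>, and the growth \<open>b^|a|\<close> of their number cancels
  against it. Every class thus obeys the same bound, and there are \<open>(m+1)^|u|\<close>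
  classes.\<close>

lemma dual_sum_le:
  assumes M: "M \<ge> 0"
    and le_M: "\<And>h. h \<in> dual_polys m p q u - {\<lambda>j\<in>u. 0} \<Longrightarrow>
                 1 / real CARD('b) ^ (\<Sum>j\<in>u. poly_length (h j)) \<le> M"
  shows "(\<Sum>h\<in>dual_polys m p q u - {\<lambda>j\<in>u. 0}.
            \<Prod>j\<in>u. k_const CARD('b) / real CARD('b) ^ poly_length (h j))
         \<le> (real CARD('b) - 1) * M * (k_const CARD('b) * (real m + 1)) ^ card u"
proof -
  let ?b = "real CARD('b)"
  let ?k = "k_const CARD('b)"
  define D where "D = dual_polys m p q u - {\<lambda>j\<in>u. 0}"
  define len where "len h = (\<Sum>j\<in>u. poly_length (h j))" for h :: "nat \<Rightarrow> 'b mod_ring poly"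
  have b: "?b \<ge> 2" using prime_ge_2_nat[OF prime_card[where ?'a = 'b]] by linarith
  have k: "?k \<ge> 1" by (rule k_const_ge_1)
  have finD: "finite D" using finite_dual_polys by (simp add: D_def)
  show ?thesis
  proof (cases "D = {}")
    case True
    have "(real CARD('b) - 1) * M * (?k * (real m + 1)) ^ card u \<ge> 0"
      using b M k by (intro mult_nonneg_nonneg zero_le_power) auto
    then show ?thesis unfolding D_def[symmetric] True by simp
  next
    case False
    define \<delta> where "\<delta> = Min (len ` D)"
    have \<delta>_le: "\<delta> \<le> len h" if "h \<in> D" for h using that finD by (simp add: \<delta>_def)
    have "\<delta> \<in> len ` D" unfolding \<delta>_def using finD False by (intro Min_in) auto
    then obtain h0 where h0: "h0 \<in> D" "\<delta> = len h0" by blast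
    \<comment> \<open>The minimum is attained, so the hypothesis at the single vector
      \<open>h0\<close> controls all classes.\<close>
    have \<delta>_M: "1 / ?b ^ \<delta> \<le> M" using le_M h0 by (simp add: D_def len_def)
    have "\<exists>j\<in>u. h0 j \<noteq> 0"
    proof (rule ccontr)
      assume "\<not> (\<exists>j\<in>u. h0 j \<noteq> 0)"
      then have "h0 = (\<lambda>j\<in>u. 0)"
        using h0(1) by (auto simp: D_def dual_polys_def PiE_def extensional_def)
      then show False using h0(1) by (simp add: D_def)
    qed
    then have "\<delta> \<ge> 1"
      using u h0(2) by (auto simp: len_def poly_length_def Suc_le_eq sum_pos2 intro!: sum_pos2)
    define T where "T = PiE u (\<lambda>_. {..m})"
    define sh where "sh h = (\<lambda>j\<in>u. poly_length (h j))" for h :: "nat \<Rightarrow> 'b mod_ring poly"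
    have finT: "finite T" using u by (simp add: T_def finite_PiE)
    have "sh ` D \<subseteq> T"
      by (auto simp: sh_def D_def T_def dual_polys_def poly_length_le_iff_polys_below PiE_iff)
    then have "(\<Sum>h\<in>D. \<Prod>j\<in>u. ?k / ?b ^ poly_length (h j))
        = (\<Sum>a\<in>T. \<Sum>h\<in>{h \<in> D. sh h = a}. \<Prod>j\<in>u. ?k / ?b ^ poly_length (h j))"
      by (intro sum.group[symmetric] finD finT)
    also have "\<dots> \<le> (\<Sum>a\<in>T. (?b - 1) * M * ?k ^ card u)"
    proof (rule sum_mono)
      fix a
      let ?E = "{h \<in> D. sh h = a}"
      show "(\<Sum>h\<in>?E. \<Prod>j\<in>u. ?k / ?b ^ poly_length (h j)) \<le> (?b - 1) * M * ?k ^ card u"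
      \<comment> \<open>A nonempty class has total length at least \<open>\<delta>\<close>, so the
        subtraction in the exponent is genuine; for an empty class the bound only has to be
        non-negative.\<close>
      proof (cases "?E = {}")
        case True
        show ?thesis unfolding True using b M k by simp
      next
        case False
        then obtain h where h: "h \<in> D" "sh h = a" by blast
        have len_a: "len h = sum a u" using h(2) by (auto simp: len_def sh_def)
        then have a_ge: "\<delta> \<le> sum a u" using \<delta>_le[OF h(1)] by simp
        have sub: "?E \<subseteq> {h \<in> dual_polys m p q u. \<forall>j\<in>u. poly_length (h j) = a j}"
          by (auto simp: D_def sh_def)
        have "card ?E \<le> (CARD('b) - 1) * CARD('b) ^ (sum a u - \<delta>)"
          by (rule order.trans[OF card_mono[OF _ sub] card_dual_length_le])
            (use finite_dual_polys \<open>\<delta> \<ge> 1\<close> \<delta>_le a_ge in \<open>auto simp: D_def len_def\<close>)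
        then have "real (card ?E) \<le> real ((CARD('b) - 1) * CARD('b) ^ (sum a u - \<delta>))"
          by (rule of_nat_mono)
        then have card_le: "real (card ?E) \<le> (?b - 1) * ?b ^ (sum a u - \<delta>)"
          using b by (simp add: of_nat_diff)
        have "(\<Sum>h\<in>?E. \<Prod>j\<in>u. ?k / ?b ^ poly_length (h j)) = (\<Sum>h\<in>?E. ?k ^ card u / ?b ^ sum a u)"
        proof (intro sum.cong refl)
          fix h assume "h \<in> ?E"
          then have "sum a u = (\<Sum>j\<in>u. poly_length (h j))" by (auto simp: sh_def)
          then show "(\<Prod>j\<in>u. ?k / ?b ^ poly_length (h j)) = ?k ^ card u / ?b ^ sum a u"
            by (simp add: prod_dividef power_sum)
        qed
        also have "\<dots> = real (card ?E) * (?k ^ card u / ?b ^ sum a u)" by simp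
        also have "\<dots> \<le> ((?b - 1) * ?b ^ (sum a u - \<delta>)) * (?k ^ card u / ?b ^ sum a u)"
          using card_le b k by (intro mult_right_mono) auto
        also have "?b ^ sum a u = ?b ^ (sum a u - \<delta>) * ?b ^ \<delta>"
          using a_ge by (simp flip: power_add)
        also have "((?b - 1) * ?b ^ (sum a u - \<delta>)) * (?k ^ card u / (?b ^ (sum a u - \<delta>) * ?b ^ \<delta>))
            = (?b - 1) * (1 / ?b ^ \<delta>) * ?k ^ card u"
          using b by simp
        also have "\<dots> \<le> (?b - 1) * M * ?k ^ card u"
          using \<delta>_M b k by (intro mult_right_mono mult_left_mono) auto
        finally show ?thesis .
      qed
    qed
    also have "\<dots> = (?b - 1) * M * (?k * (real m + 1)) ^ card u"
      using u by (simp add: T_def card_PiE power_mult_distrib mult_ac add_ac)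
    finally show ?thesis by (simp add: D_def)
  qed
qed

end

section \<open>The weighted star discrepancy\<close>

text \<open>The extreme case is \<open>x j = 1\<close> and \<open>y j = 1 - d\<close> for all
  \<open>j\<close>.\<close>

lemma prod_diff_le:
  fixes x y :: "'i \<Rightarrow> real"
  assumes "finite u" "\<And>j. j \<in> u \<Longrightarrow> 0 \<le> y j \<and> y j \<le> x j \<and> x j \<le> 1 \<and> x j - y j \<le> d"
    and d: "0 \<le> d" "d \<le> 1"
  shows "(\<Prod>j\<in>u. x j) - (\<Prod>j\<in>u. y j) \<le> 1 - (1 - d) ^ card u"
  using assms(1,2)
proof (induction u rule: finite_induct)
  case (insert i u)
  define P where "P = (\<Prod>j\<in>u. x j)"
  define Q where "Q = (\<Prod>j\<in>u. y j)"
  have IH: "P - Q \<le> 1 - (1 - d) ^ card u" unfolding P_def Q_def using insert by simp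
  have Q: "0 \<le> Q" unfolding Q_def using insert.prems by (intro prod_nonneg) auto
  have PQ: "Q \<le> P" unfolding P_def Q_def using insert.prems by (intro prod_mono) auto
  have P: "P \<le> 1" unfolding P_def
    by (intro prod_le_1) (use insert.prems in \<open>force intro: order.trans\<close>)
  have i: "x i \<le> 1" "x i - y i \<le> d" using insert.prems by auto
  have "x i * P - y i * Q = x i * (P - Q) + (x i - y i) * Q" by (simp add: algebra_simps)
  also have "\<dots> \<le> 1 * (P - Q) + d * Q"
    using i Q PQ by (intro add_mono mult_right_mono) auto
  \<comment> \<open>Regrouping as a convex combination lets the induction hypothesis bound
    \<open>P - Q\<close> and the trivial bound 1 handle \<open>P\<close>.\<close>
  also have "\<dots> = (1 - d) * (P - Q) + d * P" by (simp add: algebra_simps)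
  also have "\<dots> \<le> (1 - d) * (1 - (1 - d) ^ card u) + d * 1"
    using IH P d by (intro add_mono mult_left_mono) auto
  also have "\<dots> = 1 - (1 - d) ^ card (insert i u)"
    using insert.hyps by (simp add: algebra_simps)
  finally show ?case using insert.hyps by (simp add: P_def Q_def)
qed simp

lemma local_discrepancy_lattice_points:
  fixes p :: "'b::prime_card mod_ring poly"
  assumes m: "m \<ge> 1" and u: "u \<subseteq> {1..s}"
  shows "local_discrepancy u (proj_points u (lattice_points s m p q)) y =
    (\<Sum>n\<in>polys_below m. \<Prod>j\<in>u. of_bool (real (point_index m p q n j) / real CARD('b) ^ m < y j))
      / real CARD('b) ^ m - (\<Prod>j\<in>u. y j)"
proof -
  have fin: "finite u" using u finite_subset by blast
  have "indicator (PiE u (\<lambda>j. {0..<y j})) (restrict (lattice_point s m p q n) u) =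
      (\<Prod>j\<in>u. of_bool (real (point_index m p q n j) / real CARD('b) ^ m < y j) :: real)"
    (is "?l n = ?r n") for n
  proof -
    have eq: "lattice_point s m p q n j = real (point_index m p q n j) / real CARD('b) ^ m"
      if "j \<in> u" for j
      using that u by (auto simp: lattice_point_def laurent_trunc_eq point_index_def)
    have "restrict (lattice_point s m p q n) u \<in> PiE u (\<lambda>j. {0..<y j}) \<longleftrightarrow>
        (\<forall>j\<in>u. real (point_index m p q n j) / real CARD('b) ^ m < y j)"
      by (auto simp: PiE_iff eq)
    then show ?thesis using fin by (auto simp: indicator_def)
  qed
  then have "(\<Sum>x\<in>#proj_points u (lattice_points s m p q). indicator (PiE u (\<lambda>j. {0..<y j})) x)
      = (\<Sum>n\<in>polys_below m. ?r n)"
    by (simp add: proj_points_def lattice_points_def sum_unfold_sum_mset image_mset.compositionality o_def)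
  moreover have "size (proj_points u (lattice_points s m p q)) = CARD('b) ^ m"
    using size_lattice_points[OF m, of s p q] by (simp add: proj_points_def)
  ultimately show ?thesis by (simp add: local_discrepancy_def)
qed

lemma local_discrepancy_le:
  fixes p :: "'b::prime_card mod_ring poly"
  assumes m: "degree p = m" "m \<ge> 1" and u: "u \<subseteq> {1..s}"
    and y: "y \<in> PiE u (\<lambda>_. {0..<1})"
  shows "\<bar>local_discrepancy u (proj_points u (lattice_points s m p q)) y\<bar> \<le>
    1 - (1 - 1 / real CARD('b) ^ m) ^ card u +
    (\<Sum>h\<in>dual_polys m p q u - {\<lambda>j\<in>u. 0}.
       \<Prod>j\<in>u. k_const CARD('b) / real CARD('b) ^ poly_length (h j))"
proof -
  define N where "N = real CARD('b) ^ m"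
  have N: "N \<ge> 1" by (simp add: N_def)
  have fin: "finite u" using u finite_subset by blast
  \<comment> \<open>Comparing an integer \<open>X\<close> strictly with \<open>y j * N\<close> or
    with its ceiling gives the same answer, so rounding up leaves the count unchanged.\<close>
  define c where "c j = nat \<lceil>y j * N\<rceil>" for j
  have c: "y j * N \<le> real (c j)" "real (c j) < y j * N + 1" "c j \<le> CARD('b) ^ m"
    "X < c j \<longleftrightarrow> real X / N < y j" if "j \<in> u" for j X
  proof -
    have yj: "0 \<le> y j" "y j < 1" using y that by (auto simp: PiE_iff)
    then have pos: "0 \<le> y j * N" using N by simp
    then have cr: "real (c j) = of_int \<lceil>y j * N\<rceil>" by (simp add: c_def)
    show "y j * N \<le> real (c j)" "real (c j) < y j * N + 1"
      unfolding cr by linarith+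
    have "y j * N \<le> N" using yj N by simp
    then have "\<lceil>y j * N\<rceil> \<le> int (CARD('b) ^ m)" by (simp add: ceiling_le_iff N_def)
    then show "c j \<le> CARD('b) ^ m" by (simp only: c_def nat_le_iff)
    have "X < c j \<longleftrightarrow> real X < y j * N" by (simp add: c_def zless_nat_conj zless_nat_eq_int_zless less_ceiling_iff)
    also have "\<dots> \<longleftrightarrow> real X / N < y j" using N by (simp add: field_simps)
    finally show "X < c j \<longleftrightarrow> real X / N < y j" .
  qed
  let ?S = "\<Sum>n\<in>polys_below m. \<Prod>j\<in>u. of_bool (point_index m p q n j < c j) :: real"
  have "local_discrepancy u (proj_points u (lattice_points s m p q)) y = ?S / N - (\<Prod>j\<in>u. y j)"
    unfolding local_discrepancy_lattice_points[OF m(2) u] by (simp add: c(4) N_def[symmetric])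
  also have "\<dots> = (?S / N - (\<Prod>j\<in>u. real (c j) / N)) + ((\<Prod>j\<in>u. real (c j) / N) - (\<Prod>j\<in>u. y j))"
    by simp
  finally have eq: "local_discrepancy u (proj_points u (lattice_points s m p q)) y = \<dots>" .
  have yc: "0 \<le> y j" "y j \<le> real (c j) / N" "real (c j) / N \<le> 1" "real (c j) / N - y j \<le> 1 / N"
    if "j \<in> u" for j
  proof -
    show "0 \<le> y j" using y that by (auto simp: PiE_iff)
    show "y j \<le> real (c j) / N" using c(1)[OF that] N by (simp add: field_simps)
    have "real (c j) \<le> N" using of_nat_mono[OF c(3)[OF that], where ?'a = real] by (simp add: N_def)
    then show "real (c j) / N \<le> 1" using N by simp
    have "real (c j) / N \<le> (y j * N + 1) / N" using c(2)[OF that] N by (intro divide_right_mono) auto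
    then show "real (c j) / N - y j \<le> 1 / N" using N by (simp add: add_divide_distrib)
  qed
  have "(\<Prod>j\<in>u. y j) \<le> (\<Prod>j\<in>u. real (c j) / N)"
    using yc by (intro prod_mono) auto
  moreover have "(\<Prod>j\<in>u. real (c j) / N) - (\<Prod>j\<in>u. y j) \<le> 1 - (1 - 1 / N) ^ card u"
    using yc N by (intro prod_diff_le fin) auto
  moreover note grid_discrepancy_le[OF m fin, where c = c and q = q, OF c(3)]
  ultimately show ?thesis
    unfolding eq N_def[symmetric] by linarith
qed

text \<open>
  The component-wise codes of the nonzero components of a dual vector of polynomials form an
  element of the dual net of a projection, to which the figure of merit applies.
\<close>

lemma figure_of_merit_ge:
  fixes p :: "'b::prime_card mod_ring poly"
  assumes \<alpha>: "\<alpha> > 0" and u: "u \<in> nonempty_subsets s"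
    and nonneg: "\<And>v. v \<in> nonempty_subsets s \<Longrightarrow> \<gamma> v \<ge> 0"
    and mono: "\<And>v. v \<in> nonempty_subsets s \<Longrightarrow> v \<subseteq> u \<Longrightarrow> \<gamma> u \<le> \<gamma> v"
    and h: "h \<in> dual_polys m p q u - {\<lambda>j\<in>u. 0}"
  shows "\<gamma> u * real CARD('b) powr (- 2 * \<alpha> * real (\<Sum>j\<in>u. poly_length (h j)))
           \<le> figure_of_merit s m \<alpha> \<gamma> p q"
proof -
  \<comment> \<open>Vectors of the dual net have positive components while the zero polynomial has
    code 0, so only the support of \<open>h\<close> is encoded. The omitted components have length
    0, and the total length is preserved.\<close>
  define v where "v = {j \<in> u. h j \<noteq> 0}"
  define k where "k = (\<lambda>j\<in>v. poly_code (h j))"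
  have fin: "finite u" using u by (auto simp: nonempty_subsets_def intro: finite_subset)
  have hP: "h \<in> PiE u (\<lambda>_. polys_below m)" "p dvd (\<Sum>j\<in>u. h j * q j)" and h0: "h \<noteq> (\<lambda>j\<in>u. 0)"
    using h by (auto simp: dual_polys_def)
  have "v \<noteq> {}"
  proof
    assume "v = {}"
    then have "h = (\<lambda>j\<in>u. 0)"
      using hP(1) by (auto simp: v_def PiE_def extensional_def)
    with h0 show False by simp
  qed
  then have v: "v \<in> nonempty_subsets s" "v \<subseteq> u"
    using u by (auto simp: nonempty_subsets_def v_def)
  have "(\<Sum>j\<in>v. trunc_poly m (k j) * q j) = (\<Sum>j\<in>v. h j * q j)"
    using PiE_mem[OF hP(1)] by (intro sum.cong refl) (simp add: k_def v_def trunc_poly_poly_code)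
  also have "\<dots> = (\<Sum>j\<in>u. h j * q j)"
    using fin by (intro sum.mono_neutral_left) (auto simp: v_def)
  finally have k: "k \<in> dual_net m p q v"
    using hP(2) poly_code_pos by (auto simp: dual_net_def k_def v_def cong_0_iff)
  have "num_digits_vec CARD('b) v k = (\<Sum>j\<in>v. poly_length (h j))"
    by (simp add: num_digits_vec_def k_def v_def num_digits_poly_code poly_length_def)
  also have "\<dots> = (\<Sum>j\<in>u. poly_length (h j))"
    using fin by (intro sum.mono_neutral_left) (auto simp: v_def poly_length_def)
  finally have len: "num_digits_vec CARD('b) v k = (\<Sum>j\<in>u. poly_length (h j))" .
  let ?S = "\<lambda>v. SUP k\<in>dual_net m p q v. merit_weight CARD('b) \<alpha> \<gamma> v k"
  obtain k0 where "\<And>k'. k' \<in> dual_net m p q v \<Longrightarrow>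
      merit_weight CARD('b) \<alpha> \<gamma> v k' \<le> merit_weight CARD('b) \<alpha> \<gamma> v k0"
    and "?S v = merit_weight CARD('b) \<alpha> \<gamma> v k0"
    using merit_weight_Sup_attained[of \<alpha> \<gamma> v m p q] \<alpha> nonneg[OF v(1)] by blast
  then have "merit_weight CARD('b) \<alpha> \<gamma> v k \<le> ?S v" using k by simp
  also have "\<dots> \<le> figure_of_merit s m \<alpha> \<gamma> p q"
    unfolding figure_of_merit_def using v finite_nonempty_subsets by (intro Max_ge) auto
  finally have "\<gamma> v * real CARD('b) powr (- 2 * \<alpha> * real (\<Sum>j\<in>u. poly_length (h j)))
      \<le> figure_of_merit s m \<alpha> \<gamma> p q"
    by (simp add: merit_weight_def len)
  moreover have "\<gamma> u * real CARD('b) powr (- 2 * \<alpha> * real (\<Sum>j\<in>u. poly_length (h j)))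
      \<le> \<gamma> v * real CARD('b) powr (- 2 * \<alpha> * real (\<Sum>j\<in>u. poly_length (h j)))"
    using mono[OF v] by (intro mult_right_mono) auto
  ultimately show ?thesis by linarith
qed

lemma inverse_power_le_root:
  fixes b g \<rho> \<alpha> :: real
  assumes b: "b > 0" and \<alpha>: "\<alpha> > 0" and g: "g > 0"
    and le: "g * b powr (- 2 * \<alpha> * real l) \<le> \<rho>"
  shows "1 / b ^ l \<le> \<rho> powr (1 / (2 * \<alpha>)) / g powr (1 / (2 * \<alpha>))"
proof -
  have "\<rho> \<ge> 0" using le g by (meson less_imp_le mult_nonneg_nonneg order.trans powr_ge_zero)
  have "1 / b ^ l = b powr (- real l)"
    using b by (simp add: powr_minus powr_realpow divide_inverse)
  also have "\<dots> = (b powr (- 2 * \<alpha> * real l)) powr (1 / (2 * \<alpha>))"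
    using \<alpha> by (simp add: powr_powr)
  also have "\<dots> \<le> (\<rho> / g) powr (1 / (2 * \<alpha>))"
    using le g \<alpha> by (intro powr_mono2) (auto simp: field_simps)
  also have "\<dots> = \<rho> powr (1 / (2 * \<alpha>)) / g powr (1 / (2 * \<alpha>))"
    using g \<open>\<rho> \<ge> 0\<close> by (simp add: powr_divide)
  finally show ?thesis .
qed

theorem theorem4:
  fixes b s m N :: nat
    and p :: "'b::prime_card mod_ring poly"
    and q :: "nat \<Rightarrow> 'b mod_ring poly"
    and \<alpha> :: real
    and \<gamma> \<gamma>' :: "nat set \<Rightarrow> real"
  assumes "b = CARD('b)"
    and "s \<ge> 1" and "m \<ge> 1"
    and "degree p = m"
    and "\<And>j. j \<in> {1..s} \<Longrightarrow> q j \<in> polys_below m - {0}"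
    and "N = b ^ m"
    and "\<alpha> > 1 / 2"
    and "\<And>u. finite u \<Longrightarrow> u \<noteq> {} \<Longrightarrow> u \<subseteq> {1..} \<Longrightarrow> \<gamma> u \<ge> 0"
    and "\<And>u. finite u \<Longrightarrow> u \<noteq> {} \<Longrightarrow> u \<subseteq> {1..} \<Longrightarrow> \<gamma>' u \<ge> 0"
    and "\<And>u v. finite u \<Longrightarrow> v \<noteq> {} \<Longrightarrow> u \<subseteq> {1..} \<Longrightarrow> v \<subset> u \<Longrightarrow> \<gamma> v \<ge> \<gamma> u"
  shows "ereal (weighted_star_discrepancy s \<gamma>' (lattice_points s m p q)) \<le>
    (if \<exists>u\<in>nonempty_subsets s. \<gamma> u = 0 \<and> 0 < \<gamma>' u then \<infinity>
     else ereal (\<Sum>u\<in>nonempty_subsets s. \<gamma>' u *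
       (1 - (1 - 1 / real N) ^ card u
        + (real b - 1) * (figure_of_merit s m \<alpha> \<gamma> p q powr (1 / (2 * \<alpha>)) / \<gamma> u powr (1 / (2 * \<alpha>)))
          * (k_const b * (real m + 1)) ^ card u)))"
proof (cases "\<exists>u\<in>nonempty_subsets s. \<gamma> u = 0 \<and> 0 < \<gamma>' u")
  case False
  let ?\<rho> = "figure_of_merit s m \<alpha> \<gamma> p q"
  let ?M = "\<lambda>u. ?\<rho> powr (1 / (2 * \<alpha>)) / \<gamma> u powr (1 / (2 * \<alpha>))"
  let ?B = "\<lambda>u. \<gamma>' u * (1 - (1 - 1 / real N) ^ card u
        + (real b - 1) * ?M u * (k_const b * (real m + 1)) ^ card u)"
  let ?D = "\<lambda>u. SUP y\<in>PiE u (\<lambda>_. {0..<1}).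
        \<bar>local_discrepancy u (proj_points u (lattice_points s m p q)) y\<bar>"
  have sub: "finite u" "u \<noteq> {}" "u \<subseteq> {1..}" "u \<subseteq> {1..s}" if "u \<in> nonempty_subsets s" for u
    using that by (auto simp: nonempty_subsets_def intro: finite_subset)
  have \<gamma>: "\<gamma> u \<ge> 0" "\<gamma>' u \<ge> 0" if "u \<in> nonempty_subsets s" for u
    using sub[OF that] assms(8,9) by auto
  have b: "real b \<ge> 2"
    using prime_ge_2_nat[OF prime_card[where ?'a = 'b]] assms(1) by linarith
  have N: "real N \<ge> 1" using b assms(6) by simp
  \<comment> \<open>The discrepancy is a maximum over projections. Each term will be bounded by its
    own summand, and non-negativity of the others allows passing to the sum.\<close>
  have "?B u \<ge> 0" if "u \<in> nonempty_subsets s" for u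
  proof -
    have "k_const b \<ge> 1" unfolding assms(1) by (rule k_const_ge_1)
    moreover have "(1 - 1 / real N) ^ card u \<le> 1" using N by (intro power_le_one) auto
    ultimately show ?thesis using \<gamma>[OF that] b by (intro mult_nonneg_nonneg add_nonneg_nonneg) auto
  qed
  moreover have "\<gamma>' u * ?D u \<le> ?B u" if u: "u \<in> nonempty_subsets s" for u
  \<comment> \<open>If \<open>\<gamma>' u\<close> vanishes, both sides are 0 whatever
    \<open>\<gamma> u\<close> is, in accordance with the convention for \<open>0/0\<close>.
    Otherwise \<open>\<gamma> u > 0\<close>, since the infinite case is excluded, and the division
    is genuine.\<close>
  proof (cases "\<gamma>' u = 0")
    case gamma'_nonzero: False
    then have pos: "\<gamma> u > 0" using False u \<gamma>[OF u] by (metis less_eq_real_def)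
    have "1 / real CARD('b) ^ (\<Sum>j\<in>u. poly_length (h j)) \<le> ?M u"
      if "h \<in> dual_polys m p q u - {\<lambda>j\<in>u. 0}" for h
    proof (rule inverse_power_le_root)
      show "\<gamma> u * real CARD('b) powr (- 2 * \<alpha> * real (\<Sum>j\<in>u. poly_length (h j))) \<le> ?\<rho>"
      proof (rule figure_of_merit_ge)
        show "\<gamma> u \<le> \<gamma> v" if "v \<in> nonempty_subsets s" "v \<subseteq> u" for v
          using assms(10)[of u v] sub[OF u] sub(2)[OF that(1)] that(2) by (cases "v = u") auto
      qed (use that u assms(7) \<gamma> in auto)
    qed (use assms(7) pos in auto)
    then have dual: "(\<Sum>h\<in>dual_polys m p q u - {\<lambda>j\<in>u. 0}.
          \<Prod>j\<in>u. k_const b / real b ^ poly_length (h j))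
        \<le> (real b - 1) * ?M u * (k_const b * (real m + 1)) ^ card u"
      unfolding assms(1) by (intro dual_sum_le sub[OF u] assms(3)) auto
    have "?D u \<le> 1 - (1 - 1 / real N) ^ card u
        + (real b - 1) * ?M u * (k_const b * (real m + 1)) ^ card u"
    proof (rule cSUP_least)
      show "PiE u (\<lambda>_. {0..<1::real}) \<noteq> {}" by (simp add: PiE_eq_empty_iff)
      fix y assume "y \<in> PiE u (\<lambda>_. {0..<1::real})"
      from local_discrepancy_le[OF assms(4,3) sub(4)[OF u] this, where q = q] dual
      show "\<bar>local_discrepancy u (proj_points u (lattice_points s m p q)) y\<bar>
          \<le> 1 - (1 - 1 / real N) ^ card u
            + (real b - 1) * ?M u * (k_const b * (real m + 1)) ^ card u"
        using assms(1,6) by simp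
    qed
    then show ?thesis using \<gamma>[OF u] by (intro mult_left_mono) auto
  qed simp
  ultimately have "\<gamma>' u * ?D u \<le> sum ?B (nonempty_subsets s)" if "u \<in> nonempty_subsets s" for u
    using that finite_nonempty_subsets member_le_sum[of u "nonempty_subsets s" ?B] by force
  moreover have "{1} \<in> nonempty_subsets s" using assms(2) by (simp add: nonempty_subsets_def)
  ultimately have "weighted_star_discrepancy s \<gamma>' (lattice_points s m p q)
      \<le> sum ?B (nonempty_subsets s)"
    unfolding weighted_star_discrepancy_def using finite_nonempty_subsets
    by (intro Max.boundedI) auto
  then show ?thesis using False by simp
qed simp

end
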